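(* Assume SETH holds. Then for every $\varepsilon>0$ there is no algorithm solving incremental (or decremental) maximum $st$-flow on weighted directed graphs with $n$ nodes and $m=\tilde{O}(n)$ edges with amortized time $O(m^{1-\varepsilon})$ per operation.
   Context: Incremental (resp. decremental) maximum $st$-flow: maintain a directed graph with positive integer edge capacities and two fixed nodes $s,t$ under edge insertions (resp. deletions), and answer queries asking for the value of a maximum $s$–$t$ flow. No preprocessing is allowed. The decremental version starts from a suitable initial graph with $\tilde{O}(n)$ edges. SETH (Strong Exponential Time Hypothesis): for every $\delta>0$ there is an integer $k\ge 3$ such that $k$-SAT on $n$ variables and $O(n)$ clauses cannot be solved in time $2^{(1-\delta)n}\operatorname{poly}(n)$. *)

theory Defs
  imports Complex_Main "HOL-Library.Log_Nat"
begin

section \<open>A logarithmic-cost random access machine\<close>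

text \<open>
  Running times refer to a RAM with the logarithmic cost criterion: every elementary step is
  charged the bit lengths of the numbers and addresses involved. On numbers polynomial in the input
  size this differs from a unit-cost RAM with words of logarithmic length only by logarithmic
  factors, which neither \<open>2 powr ((1 - \<delta>) * n) * poly n\<close> (for all \<open>\<delta>\<close>) nor \<open>O(m powr (1 - \<epsilon>))\<close>
  (for all \<open>\<epsilon>\<close>) can distinguish. A unit cost for arbitrarily long numbers would be unreasonably
  strong. Programs are deterministic and structured. The memory consists of infinite arrays named by
  numbers, only finitely many of which a given program mentions; interleaving these gives an
  ordinary one-dimensional memory at constant-factor cost.
\<close>

type_synonym mem = "nat \<Rightarrow> nat \<Rightarrow> nat"

datatype bop = Plus | Minus | Times | Div

datatype expr = Num nat | Cell nat expr | Bin bop expr expr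

datatype prog =
    Skip
  | Assign nat expr expr
  | Seq prog prog
  | Branch expr prog prog
  | While expr prog

abbreviation bits :: "nat \<Rightarrow> nat" where
  "bits x \<equiv> floorlog 2 x"

fun bop_val :: "bop \<Rightarrow> nat \<Rightarrow> nat \<Rightarrow> nat" where
  "bop_val Plus x y = x + y"
| "bop_val Minus x y = x - y"
| "bop_val Times x y = x * y"
| "bop_val Div x y = x div y"

fun val :: "expr \<Rightarrow> mem \<Rightarrow> nat" where
  "val (Num k) \<sigma> = k"
| "val (Cell a e) \<sigma> = \<sigma> a (val e \<sigma>)"
| "val (Bin b e1 e2) \<sigma> = bop_val b (val e1 \<sigma>) (val e2 \<sigma>)"

fun cost :: "expr \<Rightarrow> mem \<Rightarrow> nat" where
  "cost (Num k) \<sigma> = 1 + bits k"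
| "cost (Cell a e) \<sigma> = cost e \<sigma> + 1 + bits (val e \<sigma>) + bits (\<sigma> a (val e \<sigma>))"
| "cost (Bin b e1 e2) \<sigma> = cost e1 \<sigma> + cost e2 \<sigma> + 1 + bits (val e1 \<sigma>) + bits (val e2 \<sigma>)"

text \<open>\<open>exec P \<sigma> t \<sigma>'\<close>: started in memory \<open>\<sigma>\<close>, program \<open>P\<close> halts after time \<open>t\<close> in memory \<open>\<sigma>'\<close>.\<close>

inductive exec :: "prog \<Rightarrow> mem \<Rightarrow> nat \<Rightarrow> mem \<Rightarrow> bool" where
  Skip: "exec Skip \<sigma> 1 \<sigma>"
| Assign: "exec (Assign a i e) \<sigma>
    (cost i \<sigma> + cost e \<sigma> + 1 + bits (val i \<sigma>) + bits (val e \<sigma>))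
    (\<sigma>(a := (\<sigma> a)(val i \<sigma> := val e \<sigma>)))"
| Seq: "exec P \<sigma> t \<sigma>' \<Longrightarrow> exec Q \<sigma>' u \<sigma>'' \<Longrightarrow> exec (Seq P Q) \<sigma> (t + u) \<sigma>''"
| BranchT: "val e \<sigma> \<noteq> 0 \<Longrightarrow> exec P \<sigma> t \<sigma>' \<Longrightarrow>
    exec (Branch e P Q) \<sigma> (cost e \<sigma> + 1 + bits (val e \<sigma>) + t) \<sigma>'"
| BranchF: "val e \<sigma> = 0 \<Longrightarrow> exec Q \<sigma> t \<sigma>' \<Longrightarrow>
    exec (Branch e P Q) \<sigma> (cost e \<sigma> + 1 + t) \<sigma>'"
| WhileT: "val e \<sigma> \<noteq> 0 \<Longrightarrow> exec P \<sigma> t \<sigma>' \<Longrightarrow> exec (While e P) \<sigma>' u \<sigma>'' \<Longrightarrow>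
    exec (While e P) \<sigma> (cost e \<sigma> + 1 + bits (val e \<sigma>) + t + u) \<sigma>''"
| WhileF: "val e \<sigma> = 0 \<Longrightarrow> exec (While e P) \<sigma> (cost e \<sigma> + 1) \<sigma>"

text \<open>Input is placed in the first cells of array 0; the rest of the memory is left unchanged.\<close>

definition store :: "nat list \<Rightarrow> mem \<Rightarrow> mem" where
  "store xs \<sigma> = (\<lambda>a i. if a = 0 \<and> i < length xs then xs ! i else \<sigma> a i)"

definition blank :: mem where
  "blank = (\<lambda>a i. 0)"

definition result :: "mem \<Rightarrow> nat" where
  "result \<sigma> = \<sigma> 1 0"

section \<open>The Strong Exponential Time Hypothesis\<close>

type_synonym literal = "nat \<times> bool"
type_synonym cnf = "literal list list"

definition satisfiable :: "cnf \<Rightarrow> bool" where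
  "satisfiable F \<longleftrightarrow> (\<exists>\<alpha> :: nat \<Rightarrow> bool. \<forall>C \<in> set F. \<exists>(x, b) \<in> set C. \<alpha> x = b)"

definition k_cnf :: "nat \<Rightarrow> nat \<Rightarrow> cnf \<Rightarrow> bool" where
  "k_cnf k n F \<longleftrightarrow> (\<forall>C \<in> set F. length C \<le> k \<and> (\<forall>(x, b) \<in> set C. x < n))"

fun enc_literal :: "literal \<Rightarrow> nat" where
  "enc_literal (x, b) = 2 * x + (if b then 1 else 0)"

definition enc_cnf :: "nat \<Rightarrow> cnf \<Rightarrow> nat list" where
  "enc_cnf n F = n # length F # concat (map (\<lambda>C. length C # map enc_literal C) F)"

text \<open>
  \<open>P\<close> decides \<open>k\<close>-SAT on \<open>n\<close> variables and \<open>O(n)\<close> clauses in time \<open>2\<^bsup>(1 - \<delta>)n\<^esup> poly(n)\<close>: for every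
  constant \<open>c\<close>, the time bound holds on the formulas with at most \<open>c * n\<close> clauses, where the
  polynomial may depend on \<open>c\<close>.
\<close>

definition solves_sparse_ksat :: "real \<Rightarrow> nat \<Rightarrow> prog \<Rightarrow> bool" where
  "solves_sparse_ksat \<delta> k P \<longleftrightarrow>
     (\<forall>c :: nat. \<exists>(A :: real) (p :: nat). \<forall>n F. k_cnf k n F \<and> length F \<le> c * n \<longrightarrow>
        (\<exists>t \<sigma>. exec P (store (enc_cnf n F) blank) t \<sigma> \<and>
               (result \<sigma> = 1 \<longleftrightarrow> satisfiable F) \<and>
               real t \<le> A * 2 powr ((1 - \<delta>) * real n) * real (n + 1) ^ p))"

definition SETH :: bool where
  "SETH \<longleftrightarrow> (\<forall>\<delta>>0. \<exists>k\<ge>3. \<not> (\<exists>P. solves_sparse_ksat \<delta> k P))"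

section \<open>Maximum flow\<close>

text \<open>
  A weighted directed graph on the nodes \<open>{0..<n}\<close> is given by its capacities; \<open>(u, v)\<close> is an edge
  iff \<open>g (u, v) > 0\<close>.
\<close>

type_synonym graph = "nat \<times> nat \<Rightarrow> nat"

definition edges :: "graph \<Rightarrow> (nat \<times> nat) set" where
  "edges g = {e. g e > 0}"

definition is_flow :: "nat \<Rightarrow> graph \<Rightarrow> nat \<Rightarrow> nat \<Rightarrow> (nat \<times> nat \<Rightarrow> real) \<Rightarrow> bool" where
  "is_flow n g s t f \<longleftrightarrow>
     (\<forall>e. 0 \<le> f e \<and> f e \<le> real (g e)) \<and>
     (\<forall>v<n. v \<noteq> s \<and> v \<noteq> t \<longrightarrow> (\<Sum>u<n. f (u, v)) = (\<Sum>u<n. f (v, u)))"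

definition flow_value :: "nat \<Rightarrow> nat \<Rightarrow> (nat \<times> nat \<Rightarrow> real) \<Rightarrow> real" where
  "flow_value n s f = (\<Sum>u<n. f (s, u)) - (\<Sum>u<n. f (u, s))"

definition is_max_flow_value :: "nat \<Rightarrow> graph \<Rightarrow> nat \<Rightarrow> nat \<Rightarrow> real \<Rightarrow> bool" where
  "is_max_flow_value n g s t x \<longleftrightarrow>
     (\<exists>f. is_flow n g s t f \<and> flow_value n s f = x) \<and>
     (\<forall>f. is_flow n g s t f \<longrightarrow> flow_value n s f \<le> x)"

section \<open>Partially dynamic maximum flow\<close>

datatype operation = Insert nat nat nat | Delete nat nat | Query

fun apply_op :: "operation \<Rightarrow> graph \<Rightarrow> graph" where
  "apply_op (Insert u v c) g = g((u, v) := c)"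
| "apply_op (Delete u v) g = g((u, v) := 0)"
| "apply_op Query g = g"

definition graph_after :: "operation list \<Rightarrow> graph" where
  "graph_after ops = fold apply_op ops (\<lambda>_. 0)"

text \<open>Graphs are simple: no loops, and an edge is inserted only if absent. Capacities are at most \<open>n ^ w\<close>.\<close>

fun valid_op :: "nat \<Rightarrow> nat \<Rightarrow> graph \<Rightarrow> operation \<Rightarrow> bool" where
  "valid_op n w g (Insert u v c) \<longleftrightarrow>
     u < n \<and> v < n \<and> u \<noteq> v \<and> g (u, v) = 0 \<and> 0 < c \<and> c \<le> n ^ w"
| "valid_op n w g (Delete u v) \<longleftrightarrow> g (u, v) > 0"
| "valid_op n w g Query \<longleftrightarrow> True"

definition valid_ops :: "nat \<Rightarrow> nat \<Rightarrow> operation list \<Rightarrow> bool" where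
  "valid_ops n w ops \<longleftrightarrow> (\<forall>i<length ops. valid_op n w (graph_after (take i ops)) (ops ! i))"

fun is_insert :: "operation \<Rightarrow> bool" where
  "is_insert (Insert _ _ _) \<longleftrightarrow> True"
| "is_insert _ \<longleftrightarrow> False"

fun is_delete :: "operation \<Rightarrow> bool" where
  "is_delete (Delete _ _) \<longleftrightarrow> True"
| "is_delete _ \<longleftrightarrow> False"

text \<open>
  The graph has at most polylogarithmic average degree. The lower bound \<open>n \<le> m\<close> makes reading a
  single node name affordable within \<open>m powr (1 - \<epsilon>)\<close>.
\<close>

definition nearly_linear :: "nat \<Rightarrow> nat \<Rightarrow> nat \<Rightarrow> bool" where
  "nearly_linear c n m \<longleftrightarrow> n \<le> m \<and> real m \<le> real c * real n * log 2 (real n) ^ c"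

text \<open>
  A data structure is a program that is run once for each message and keeps its memory in between.
  The answer to a message has to be produced before the next message is seen.
\<close>

inductive serve :: "prog \<Rightarrow> nat list list \<Rightarrow> mem \<Rightarrow> nat \<Rightarrow> nat list \<Rightarrow> bool" where
  Nil: "serve P [] \<sigma> 0 []"
| Cons: "exec P (store msg \<sigma>) t \<sigma>' \<Longrightarrow> serve P msgs \<sigma>' u outs \<Longrightarrow>
    serve P (msg # msgs) \<sigma> (t + u) (result \<sigma>' # outs)"

definition start_msg :: "nat \<Rightarrow> nat \<Rightarrow> nat \<Rightarrow> nat list" where
  "start_msg n s t = [0, n, s, t]"

fun op_msg :: "operation \<Rightarrow> nat list" where
  "op_msg (Insert u v c) = [1, u, v, c]"
| "op_msg (Delete u v) = [2, u, v, 0]"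
| "op_msg Query = [3, 0, 0, 0]"

text \<open>
  Starting from the blank memory (there is no preprocessing), \<open>P\<close> serves all operations, answers
  every query correctly, and takes total time at most \<open>T\<close>. The first output belongs to the start
  message.
\<close>

definition maintains_max_flow ::
    "prog \<Rightarrow> nat \<Rightarrow> nat \<Rightarrow> nat \<Rightarrow> operation list \<Rightarrow> real \<Rightarrow> bool" where
  "maintains_max_flow P n s t ops T \<longleftrightarrow>
     (\<exists>time out0 outs.
        serve P (start_msg n s t # map op_msg ops) blank time (out0 # outs) \<and>
        (\<forall>i<length ops. ops ! i = Query \<longrightarrow>
           is_max_flow_value n (graph_after (take i ops)) s t (real (outs ! i))) \<and>
        real time \<le> T)"

text \<open>Incremental: \<open>m\<close> is the number of edges of the final graph.\<close>

definition solves_incremental_max_flow :: "nat \<Rightarrow> nat \<Rightarrow> real \<Rightarrow> prog \<Rightarrow> bool" where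
  "solves_incremental_max_flow c w \<epsilon> P \<longleftrightarrow>
     (\<exists>A :: real. \<forall>n s t ops. let m = card (edges (graph_after ops)) in
        s < n \<and> t < n \<and> s \<noteq> t \<and> valid_ops n w ops \<and>
        (\<forall>q \<in> set ops. is_insert q \<or> q = Query) \<and> nearly_linear c n m \<longrightarrow>
        maintains_max_flow P n s t ops (A * real m powr (1 - \<epsilon>) * real (length ops)))"

text \<open>
  Decremental: \<open>m\<close> is the number of edges of the initial graph, which the algorithm receives edge by
  edge. In the absence of preprocessing the time spent on this is part of the total, and each initial
  edge counts as one operation.
\<close>

definition solves_decremental_max_flow :: "nat \<Rightarrow> nat \<Rightarrow> real \<Rightarrow> prog \<Rightarrow> bool" where
  "solves_decremental_max_flow c w \<epsilon> P \<longleftrightarrow>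
     (\<exists>A :: real. \<forall>n s t init ops. let m = card (edges (graph_after init)) in
        s < n \<and> t < n \<and> s \<noteq> t \<and> valid_ops n w (init @ ops) \<and>
        (\<forall>q \<in> set init. is_insert q) \<and>
        (\<forall>q \<in> set ops. is_delete q \<or> q = Query) \<and> nearly_linear c n m \<longrightarrow>
        maintains_max_flow P n s t (init @ ops)
          (A * real m powr (1 - \<epsilon>) * real (length (init @ ops))))"

end

theory Submission
  imports Defs
begin

text \<open>
  Split the variables into two halves with \<open>N \<approx> 2 powr (n / 2)\<close> assignments each. In a network
  source \<rightarrow> left assignments \<rightarrow> clauses \<rightarrow> right assignments \<rightarrow> sink, an assignment is joined to the
  clauses that it does not satisfy, so a left assignment fails to reach some right assignment iff
  the two together satisfy the formula. Give every source arc capacity \<open>N\<close> and every sink arc of a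
  right assignment capacity \<open>1\<close>. After the query for a left assignment, an arc of capacity \<open>N\<close> from
  it directly to the sink absorbs all of its flow; hence, although nothing is ever deleted, the
  next query sees only the next assignment: the flow is saturated iff that assignment reaches
  all right assignments. Reading the sequence backwards yields the decremental version. There are
  \<open>N * poly n\<close> operations on \<open>N * poly n\<close> edges, so time \<open>m powr (1 - \<epsilon>)\<close> per operation would decide
  satisfiability in time \<open>2 powr ((1 - \<epsilon> / 2) * n) * poly n\<close>.
\<close>

section \<open>Running programs\<close>

text \<open>Two numerical choices shape the network. \<open>N\<close> is exactly the total capacity
  of the unit arcs behind the second half, so the one live left assignment saturates its source arc
  iff every unit arc is used; a single unreachable right assignment costs at least one unit. The
  halves are balanced because the number of arcs and the number of operations are both about
  \<open>N\<close>: the total \<open>N powr (2 - \<epsilon>)\<close> has to beat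
  \<open>2 ^ n\<close>, which fixes \<open>N\<close> at about \<open>2 ^ (n / 2)\<close>. The
  obstacle is that hardness is asserted for concrete programs under logarithmic cost. The given
  program \<open>P\<close> has to run as a subroutine that starts on blank memory and gets its
  messages one at a time, while the reduction keeps its own data out of its reach. Since the clause
  width \<open>kk\<close> is a constant, each operation can be produced by loop-free code; such code
  takes time linear in a common bit width \<open>b\<close>, and \<open>b\<close> is linear in
  \<open>n\<close> when there are \<open>O(n)\<close> clauses. So the overhead is \<open>N\<close>
  times a polynomial, and \<open>P\<close> is charged exactly its own time.\<close>

lemma bits_le_iff: "bits x \<le> w \<longleftrightarrow> x < 2 ^ w"
  by (simp add: floorlog_le_iff)

lemma less_two_power_bits: "x < 2 ^ bits x"
  by (simp add: floorlog_leD)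

lemma bits_mono: "x \<le> y \<Longrightarrow> bits x \<le> bits y"
  using less_two_power_bits[of y] by (simp add: bits_le_iff)

lemma bits_mult_le: "bits (x * y) \<le> bits x + bits y"
  unfolding bits_le_iff power_add
  by (intro mult_strict_mono' less_two_power_bits) auto

lemma bits_add_le: "bits (x + y) \<le> 1 + bits x + bits y"
proof -
  have "x < 2 ^ (bits x + bits y)" "y < 2 ^ (bits x + bits y)"
    by (rule less_le_trans[OF less_two_power_bits], simp)+
  then show ?thesis unfolding bits_le_iff by simp
qed

lemma bits_bop_val_le: "bits (bop_val b x y) \<le> 1 + bits x + bits y"
  using bits_add_le[of x y] bits_mult_le[of x y] bits_mono[of "x - y" x] bits_mono[of "x div y" x]
  by (cases b) auto

fun arrays :: "expr \<Rightarrow> nat set" where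
  "arrays (Num k) = {}"
| "arrays (Cell a e) = insert a (arrays e)"
| "arrays (Bin b e1 e2) = arrays e1 \<union> arrays e2"

fun accessed :: "prog \<Rightarrow> nat set" where
  "accessed Skip = {}"
| "accessed (Assign a i e) = insert a (arrays i \<union> arrays e)"
| "accessed (Seq P Q) = accessed P \<union> accessed Q"
| "accessed (Branch e P Q) = arrays e \<union> accessed P \<union> accessed Q"
| "accessed (While e P) = arrays e \<union> accessed P"

fun read :: "prog \<Rightarrow> nat set" where
  "read Skip = {}"
| "read (Assign a i e) = arrays i \<union> arrays e"
| "read (Seq P Q) = read P \<union> read Q"
| "read (Branch e P Q) = arrays e \<union> read P \<union> read Q"
| "read (While e P) = arrays e \<union> read P"

fun loop_free :: "prog \<Rightarrow> bool" where
  "loop_free (Seq P Q) \<longleftrightarrow> loop_free P \<and> loop_free Q"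
| "loop_free (Branch e P Q) \<longleftrightarrow> loop_free P \<and> loop_free Q"
| "loop_free (While e P) \<longleftrightarrow> False"
| "loop_free _ \<longleftrightarrow> True"

text \<open>A functional counterpart of \<open>exec\<close> for loop-free code, so that the
  simplifier can compute final memories.\<close>

fun sem :: "prog \<Rightarrow> mem \<Rightarrow> mem" where
  "sem Skip \<sigma> = \<sigma>"
| "sem (Assign a i e) \<sigma> = \<sigma>(a := (\<sigma> a)(val i \<sigma> := val e \<sigma>))"
| "sem (Seq P Q) \<sigma> = sem Q (sem P \<sigma>)"
| "sem (Branch e P Q) \<sigma> = (if val e \<sigma> \<noteq> 0 then sem P \<sigma> else sem Q \<sigma>)"
| "sem (While e P) \<sigma> = \<sigma>"

lemma sem_Assign: "sem (Assign a i e) \<sigma> = \<sigma>(a := (\<sigma> a)(val i \<sigma> := val e \<sigma>))"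
  by (simp add: fun_upd_def)

declare sem.simps(2) [simp del] sem_Assign [simp]

definition runs :: "prog \<Rightarrow> mem \<Rightarrow> nat \<Rightarrow> mem \<Rightarrow> bool" where
  "runs P \<sigma> T \<sigma>' \<longleftrightarrow> (\<exists>t\<le>T. exec P \<sigma> t \<sigma>')"

text \<open>Only the arrays in \<open>R\<close> are bounded, because a subroutine may keep numbers
  of any length in its own arrays. The conjunct \<open>1 \<le> b\<close> lets additive constants be
  absorbed into multiples of \<open>b\<close>.\<close>

definition small :: "nat \<Rightarrow> nat set \<Rightarrow> mem \<Rightarrow> bool" where
  "small b R \<sigma> \<longleftrightarrow> 1 \<le> b \<and> (\<forall>a\<in>R. \<forall>i. bits (\<sigma> a i) \<le> b)"

lemma runs_mono: "runs P \<sigma> T \<sigma>' \<Longrightarrow> T \<le> T' \<Longrightarrow> runs P \<sigma> T' \<sigma>'"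
  unfolding runs_def by (meson le_trans)

lemma runs_Seq: "runs P \<sigma> T \<sigma>' \<Longrightarrow> runs Q \<sigma>' U \<sigma>'' \<Longrightarrow> runs (Seq P Q) \<sigma> (T + U) \<sigma>''"
  unfolding runs_def by (meson add_mono exec.Seq)

lemma small_mono: "small b R \<sigma> \<Longrightarrow> b \<le> b' \<Longrightarrow> R' \<subseteq> R \<Longrightarrow> small b' R' \<sigma>"
  unfolding small_def by (meson le_trans subsetD)

text \<open>An operator yields at most the sum of its arguments' bit lengths plus one, so the factor
  \<open>K\<close> depends on the shape of \<open>e\<close> alone.\<close>

lemma expr_cost_bound:
  "\<exists>K\<ge>1. \<forall>\<sigma> b. small b (arrays e) \<sigma> \<longrightarrow> cost e \<sigma> \<le> K * b \<and> bits (val e \<sigma>) \<le> K * b"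
proof (induction e)
  case (Num k)
  have "cost (Num k) \<sigma> \<le> (1 + bits k) * b \<and> bits (val (Num k) \<sigma>) \<le> (1 + bits k) * b"
    if "small b (arrays (Num k)) \<sigma>" for \<sigma> b
    using that by (cases b) (auto simp: small_def)
  then show ?case by (intro exI[of _ "1 + bits k"]) auto
next
  case (Cell a e)
  then obtain K where K: "\<And>\<sigma> b. small b (arrays e) \<sigma> \<Longrightarrow> cost e \<sigma> \<le> K * b \<and> bits (val e \<sigma>) \<le> K * b"
    by auto
  have "cost (Cell a e) \<sigma> \<le> (2 * K + 2) * b \<and> bits (val (Cell a e) \<sigma>) \<le> (2 * K + 2) * b"
    if s: "small b (arrays (Cell a e)) \<sigma>" for \<sigma> b
  proof -
    have "small b (arrays e) \<sigma>" "1 \<le> b" "bits (\<sigma> a (val e \<sigma>)) \<le> b"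
      using s by (auto simp: small_def)
    then show ?thesis using K[of b \<sigma>] by (auto simp: algebra_simps)
  qed
  then show ?case by (intro exI[of _ "2 * K + 2"]) auto
next
  case (Bin op e1 e2)
  then obtain K L where
    K: "\<And>\<sigma> b. small b (arrays e1) \<sigma> \<Longrightarrow> cost e1 \<sigma> \<le> K * b \<and> bits (val e1 \<sigma>) \<le> K * b" and
    L: "\<And>\<sigma> b. small b (arrays e2) \<sigma> \<Longrightarrow> cost e2 \<sigma> \<le> L * b \<and> bits (val e2 \<sigma>) \<le> L * b"
    by auto
  have "cost (Bin op e1 e2) \<sigma> \<le> (2 * K + 2 * L + 1) * b
      \<and> bits (val (Bin op e1 e2) \<sigma>) \<le> (2 * K + 2 * L + 1) * b"
    if s: "small b (arrays (Bin op e1 e2)) \<sigma>" for \<sigma> b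
  proof -
    have "small b (arrays e1) \<sigma>" "small b (arrays e2) \<sigma>" "1 \<le> b"
      using s by (auto simp: small_def)
    then show ?thesis
      using K[of b \<sigma>] L[of b \<sigma>] bits_bop_val_le[of op "val e1 \<sigma>" "val e2 \<sigma>"]
      by (auto simp: algebra_simps)
  qed
  then show ?case by (intro exI[of _ "2 * K + 2 * L + 1"]) auto
qed

text \<open>
  Bit lengths grow at most by a constant factor along loop-free code, so its running time is linear
  in the largest bit length of the cells that it may read.
\<close>

lemma loop_free_runs_growth:
  assumes "loop_free P" "read P \<subseteq> R"
  shows "\<exists>K\<ge>1. \<forall>\<sigma> b. small b R \<sigma> \<longrightarrow> runs P \<sigma> (K * b) (sem P \<sigma>) \<and> small (K * b) R (sem P \<sigma>)"
  using assms
proof (induction P)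
  case Skip
  have "runs Skip \<sigma> (1 * b) (sem Skip \<sigma>) \<and> small (1 * b) R (sem Skip \<sigma>)" if "small b R \<sigma>" for \<sigma> b
    using that exec.Skip[of \<sigma>] by (auto simp: small_def runs_def)
  then show ?case by blast
next
  case (Assign a i e)
  obtain K L where
    K: "\<And>\<sigma> b. small b (arrays i) \<sigma> \<Longrightarrow> cost i \<sigma> \<le> K * b \<and> bits (val i \<sigma>) \<le> K * b" and
    L: "\<And>\<sigma> b. small b (arrays e) \<sigma> \<Longrightarrow> cost e \<sigma> \<le> L * b \<and> bits (val e \<sigma>) \<le> L * b"
    using expr_cost_bound by meson
  have "runs (Assign a i e) \<sigma> ((2 * K + 2 * L + 1) * b) (sem (Assign a i e) \<sigma>)
      \<and> small ((2 * K + 2 * L + 1) * b) R (sem (Assign a i e) \<sigma>)"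
    if s: "small b R \<sigma>" for \<sigma> b
  proof -
    have 1: "small b (arrays i) \<sigma>" "small b (arrays e) \<sigma>" "1 \<le> b"
      using s Assign.prems small_mono[OF s le_refl] by (auto simp: small_def)
    have 2: "b \<le> (2 * K + 2 * L + 1) * b" by simp
    have "cost i \<sigma> + cost e \<sigma> + 1 + bits (val i \<sigma>) + bits (val e \<sigma>) \<le> (2 * K + 2 * L + 1) * b"
      and 3: "bits (val e \<sigma>) \<le> (2 * K + 2 * L + 1) * b"
      using K[OF 1(1)] L[OF 1(2)] 1(3) by (auto simp: algebra_simps)
    then have "runs (Assign a i e) \<sigma> ((2 * K + 2 * L + 1) * b) (sem (Assign a i e) \<sigma>)"
      using exec.Assign[of a i e \<sigma>] unfolding runs_def by auto
    moreover have "small ((2 * K + 2 * L + 1) * b) R (sem (Assign a i e) \<sigma>)"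
      using small_mono[OF s 2 order_refl] 3 by (auto simp: small_def)
    ultimately show ?thesis by blast
  qed
  moreover have "1 \<le> 2 * K + 2 * L + 1" by simp
  ultimately show ?case by blast
next
  case (Seq P Q)
  then obtain K L where
    K: "K \<ge> 1" "\<And>\<sigma> b. small b R \<sigma> \<Longrightarrow> runs P \<sigma> (K * b) (sem P \<sigma>) \<and> small (K * b) R (sem P \<sigma>)" and
    L: "L \<ge> 1" "\<And>\<sigma> b. small b R \<sigma> \<Longrightarrow> runs Q \<sigma> (L * b) (sem Q \<sigma>) \<and> small (L * b) R (sem Q \<sigma>)"
    by auto
  have "runs (Seq P Q) \<sigma> ((K + L * K) * b) (sem (Seq P Q) \<sigma>) \<and>
      small ((K + L * K) * b) R (sem (Seq P Q) \<sigma>)" if s: "small b R \<sigma>" for \<sigma> b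
  proof -
    note 1 = K(2)[OF s] and 2 = L(2)[OF conjunct2[OF K(2)[OF s]]]
    \<comment> \<open>\<open>Q\<close> starts on numbers of length up to \<open>K * b\<close>, hence
      the factor \<open>L * K\<close>.\<close>
    have "runs (Seq P Q) \<sigma> (K * b + L * (K * b)) (sem Q (sem P \<sigma>))"
      using 1 2 by (intro runs_Seq) auto
    moreover have "small ((K + L * K) * b) R (sem Q (sem P \<sigma>))"
      using 2 by (auto intro: small_mono simp: algebra_simps)
    ultimately show ?thesis by (simp add: algebra_simps)
  qed
  then show ?case using K(1) by (intro exI[of _ "K + L * K"]) auto
next
  case (Branch e P Q)
  obtain K L M where
    K: "\<And>\<sigma> b. small b R \<sigma> \<Longrightarrow> runs P \<sigma> (K * b) (sem P \<sigma>) \<and> small (K * b) R (sem P \<sigma>)" and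
    L: "\<And>\<sigma> b. small b R \<sigma> \<Longrightarrow> runs Q \<sigma> (L * b) (sem Q \<sigma>) \<and> small (L * b) R (sem Q \<sigma>)" and
    M: "\<And>\<sigma> b. small b (arrays e) \<sigma> \<Longrightarrow> cost e \<sigma> \<le> M * b \<and> bits (val e \<sigma>) \<le> M * b"
    using Branch expr_cost_bound[of e] by auto
  let ?C = "K + L + 2 * M + 1"
  have "runs (Branch e P Q) \<sigma> (?C * b) (sem (Branch e P Q) \<sigma>) \<and>
      small (?C * b) R (sem (Branch e P Q) \<sigma>)" if s: "small b R \<sigma>" for \<sigma> b
  proof
    have 1: "cost e \<sigma> \<le> M * b" "bits (val e \<sigma>) \<le> M * b" "1 \<le> b"
      using M[of b \<sigma>] Branch.prems small_mono[OF s le_refl, of "arrays e"] s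
      by (auto simp: small_def)
    show "runs (Branch e P Q) \<sigma> (?C * b) (sem (Branch e P Q) \<sigma>)"
    proof (cases "val e \<sigma> = 0")
      case True
      obtain t where t: "t \<le> L * b" "exec Q \<sigma> t (sem Q \<sigma>)"
        using L[OF s] by (auto simp: runs_def)
      have "cost e \<sigma> + 1 + t \<le> ?C * b"
        using 1 t(1) by (simp add: algebra_simps)
      then show ?thesis using exec.BranchF[OF True t(2), of P] True
        by (auto simp: runs_def)
    next
      case False
      obtain t where t: "t \<le> K * b" "exec P \<sigma> t (sem P \<sigma>)"
        using K[OF s] by (auto simp: runs_def)
      have "cost e \<sigma> + 1 + bits (val e \<sigma>) + t \<le> ?C * b"
        using 1 t(1) by (simp add: algebra_simps)
      then show ?thesis using exec.BranchT[OF False t(2), of Q] False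
        by (auto simp: runs_def)
    qed
    have "small (?C * b) R (sem P \<sigma>)" "small (?C * b) R (sem Q \<sigma>)"
      using K[OF s] L[OF s] by (auto elim!: small_mono simp: algebra_simps)
    then show "small (?C * b) R (sem (Branch e P Q) \<sigma>)" by simp
  qed
  then show ?case by (intro exI[of _ ?C]) auto
qed simp

lemma loop_free_runs:
  assumes "loop_free P"
  shows "\<exists>K. \<forall>\<sigma> b. small b (read P) \<sigma> \<longrightarrow> runs P \<sigma> (K * b) (sem P \<sigma>)"
  using loop_free_runs_growth[OF assms order_refl] by blast

text \<open>\<open>S q\<close> is the memory after \<open>q\<close> rounds; \<open>Suc c\<close>
  instead of \<open>c\<close> pays for the last, failing test.\<close>

lemma runs_While:
  assumes "\<And>q. q < c \<Longrightarrow> val e (S q) \<noteq> 0" "val e (S c) = 0"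
    and "\<And>q. q \<le> c \<Longrightarrow> cost e (S q) \<le> U \<and> bits (val e (S q)) \<le> U"
    and "\<And>q. q < c \<Longrightarrow> runs P (S q) T (S (Suc q))"
  shows "runs (While e P) (S 0) (Suc c * (T + 2 * U + 1)) (S c)"
proof -
  \<comment> \<open>Induction on the number \<open>d\<close> of rounds still to come, since
    \<open>exec\<close> unfolds a loop from its front.\<close>
  have "runs (While e P) (S (c - d)) (Suc d * (T + 2 * U + 1)) (S c)" if "d \<le> c" for d
    using that
  proof (induction d)
    case 0
    then show ?case using exec.WhileF[OF assms(2), of P] assms(3)[of c]
      by (auto simp: runs_def intro!: exI[of _ "cost e (S c) + 1"])
  next
    case (Suc d)
    let ?q = "c - Suc d"
    have q: "?q < c" "Suc ?q = c - d" using Suc.prems by auto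
    obtain t where t: "t \<le> T" "exec P (S ?q) t (S (c - d))"
      using assms(4)[OF q(1)] q(2) by (auto simp: runs_def)
    obtain u where u: "u \<le> Suc d * (T + 2 * U + 1)" "exec (While e P) (S (c - d)) u (S c)"
      using Suc by (auto simp: runs_def)
    have "cost e (S ?q) + 1 + bits (val e (S ?q)) + t + u \<le> Suc (Suc d) * (T + 2 * U + 1)"
      using assms(3)[of ?q] t(1) u(1) by simp
    then show ?case using exec.WhileT[OF assms(1)[OF q(1)] t(2) u(2)]
      unfolding runs_def by blast
  qed
  from this[of c] show ?thesis by simp
qed

text \<open>
  A program that accesses only arrays below \<open>B\<close> can be run as a subroutine, with memory \<open>\<tau>\<close>, by a
  program that keeps its own data \<open>z\<close> in the remaining arrays.
\<close>

definition join :: "nat \<Rightarrow> mem \<Rightarrow> mem \<Rightarrow> mem" where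
  "join B \<tau> z = (\<lambda>a. if a < B then \<tau> a else z (a - B))"

lemma join_upper [simp]: "join B \<tau> z (B + a) = z a"
  by (simp add: join_def)

lemma join_lower [simp]: "a < B \<Longrightarrow> join B \<tau> z a = \<tau> a"
  by (simp add: join_def)

lemma join_update_upper [simp]: "(join B \<tau> z)(B + a := f) = join B \<tau> (z(a := f))"
  by (auto simp: join_def fun_eq_iff)

lemma join_update_lower [simp]: "a < B \<Longrightarrow> (join B \<tau> z)(a := f) = join B (\<tau>(a := f)) z"
  by (auto simp: join_def fun_eq_iff)

lemma eval_join:
  "arrays e \<subseteq> {..<B} \<Longrightarrow> val e (join B \<tau> z) = val e \<tau> \<and> cost e (join B \<tau> z) = cost e \<tau>"
  by (induction e) auto

text \<open>A frame property with unchanged cost: code confined to arrays below \<open>B\<close>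
  neither sees nor alters \<open>z\<close>.\<close>

lemma exec_join:
  "exec P \<tau> t \<tau>' \<Longrightarrow> accessed P \<subseteq> {..<B} \<Longrightarrow> exec P (join B \<tau> z) t (join B \<tau>' z)"
proof (induction rule: exec.induct)
  case (Assign a i e \<sigma>)
  then have "val i (join B \<sigma> z) = val i \<sigma>" "cost i (join B \<sigma> z) = cost i \<sigma>"
    "val e (join B \<sigma> z) = val e \<sigma>" "cost e (join B \<sigma> z) = cost e \<sigma>" "a < B"
    using eval_join[of i B \<sigma> z] eval_join[of e B \<sigma> z] by auto
  then show "exec (Assign a i e) (join B \<sigma> z)
      (cost i \<sigma> + cost e \<sigma> + 1 + bits (val i \<sigma>) + bits (val e \<sigma>))
      (join B (\<sigma>(a := (\<sigma> a)(val i \<sigma> := val e \<sigma>))) z)"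
    using exec.Assign[of a i e "join B \<sigma> z"] by simp
next
  case (BranchT e \<sigma> P t \<sigma>' Q)
  then show ?case
    using eval_join[of e B \<sigma> z] exec.BranchT[of e "join B \<sigma> z" P t "join B \<sigma>' z" Q] by auto
next
  case (BranchF e \<sigma> Q t \<sigma>' P)
  then show ?case
    using eval_join[of e B \<sigma> z] exec.BranchF[of e "join B \<sigma> z" Q t "join B \<sigma>' z" P] by auto
next
  case (WhileT e \<sigma> P t \<sigma>' u \<sigma>'')
  then show ?case
    using eval_join[of e B \<sigma> z]
      exec.WhileT[of e "join B \<sigma> z" P t "join B \<sigma>' z" u "join B \<sigma>'' z"] by auto
next
  case (WhileF e \<sigma> P)
  then show ?case using eval_join[of e B \<sigma> z] exec.WhileF[of e "join B \<sigma> z" P] by auto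
next
  case (Skip \<sigma>)
  show ?case by (rule exec.Skip)
qed (auto intro: exec.intros)

lemma finite_arrays: "finite (arrays e)"
  by (induction e) auto

lemma finite_accessed: "finite (accessed P)"
  by (induction P) (auto simp: finite_arrays)

section \<open>The flow network of a formula\<close>

definition arc :: "nat \<Rightarrow> nat \<Rightarrow> nat \<Rightarrow> nat \<Rightarrow> real" where
  "arc p q u v = of_bool (u = p \<and> v = q)"

lemma arc_nonneg: "0 \<le> arc p q u v"
  by (simp add: arc_def)

lemma sum_arc_in: "p < n \<Longrightarrow> (\<Sum>u<n. arc p q u v) = of_bool (v = q)"
  by (cases "v = q") (auto simp: arc_def of_bool_def)

lemma sum_arc_out: "q < n \<Longrightarrow> (\<Sum>u<n. arc p q v u) = of_bool (v = p)"
  by (cases "v = p") (auto simp: arc_def of_bool_def)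

lemma sum_sum_arcs:
  assumes "finite A" "\<And>a. a \<in> A \<Longrightarrow> p a < n" "\<And>a. a \<in> A \<Longrightarrow> q a < n"
  shows "(\<Sum>u<n. \<Sum>v<n. \<Sum>a\<in>A. arc (p a) (q a) u v) = real (card A)"
proof -
  have "(\<Sum>u<n. \<Sum>v<n. \<Sum>a\<in>A. arc (p a) (q a) u v) = (\<Sum>u<n. \<Sum>a\<in>A. \<Sum>v<n. arc (p a) (q a) u v)"
    by (intro sum.cong refl sum.swap)
  also have "\<dots> = (\<Sum>a\<in>A. \<Sum>u<n. \<Sum>v<n. arc (p a) (q a) u v)"
    by (rule sum.swap)
  also have "\<dots> = (\<Sum>a\<in>A. 1)"
    using assms by (intro sum.cong) (auto simp: sum_arc_out of_bool_def)
  finally show ?thesis by simp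
qed

text \<open>Weak duality. By conservation, summing the net outflow over \<open>S\<close> leaves only
  that of \<open>s\<close>; arcs inside \<open>S\<close> cancel, and the flow back into
  \<open>S\<close> is nonnegative.\<close>

lemma flow_value_le_cut:
  assumes "is_flow n g s t f" "S \<subseteq> {..<n}" "s \<in> S" "t \<notin> S"
  shows "flow_value n s f \<le> (\<Sum>u\<in>S. \<Sum>v\<in>{..<n} - S. real (g (u, v)))"
proof -
  let ?T = "{..<n} - S"
  let ?d = "\<lambda>v. (\<Sum>u<n. f (v, u)) - (\<Sum>u<n. f (u, v))"
  have fin: "finite S" using assms(2) finite_subset by blast
  have split: "(\<Sum>u<n. h u) = (\<Sum>u\<in>S. h u) + (\<Sum>u\<in>?T. h u)" for h :: "nat \<Rightarrow> real"
    using sum.subset_diff[OF assms(2), of h] by simp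
  have z: "?d v = 0" if "v \<in> S - {s}" for v
    using that assms by (auto simp: is_flow_def)
  have "flow_value n s f = (\<Sum>v\<in>S. ?d v)"
    unfolding flow_value_def by (subst sum.remove[OF fin assms(3)]) (simp add: sum.neutral z del: sum_subtractf)
  also have "\<dots> = (\<Sum>v\<in>S. \<Sum>u\<in>S. f (v, u)) + (\<Sum>v\<in>S. \<Sum>u\<in>?T. f (v, u))
      - (\<Sum>v\<in>S. \<Sum>u\<in>S. f (u, v)) - (\<Sum>v\<in>S. \<Sum>u\<in>?T. f (u, v))"
    by (simp add: split sum.distrib sum_subtractf)
  also have "(\<Sum>v\<in>S. \<Sum>u\<in>S. f (u, v)) = (\<Sum>v\<in>S. \<Sum>u\<in>S. f (v, u))"
    by (rule sum.swap)
  finally have "flow_value n s f = (\<Sum>v\<in>S. \<Sum>u\<in>?T. f (v, u)) - (\<Sum>v\<in>S. \<Sum>u\<in>?T. f (u, v))"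
    by simp
  moreover have "(\<Sum>v\<in>S. \<Sum>u\<in>?T. f (u, v)) \<ge> 0"
    using assms(1) by (intro sum_nonneg) (auto simp: is_flow_def)
  moreover have "(\<Sum>v\<in>S. \<Sum>u\<in>?T. f (v, u)) \<le> (\<Sum>v\<in>S. \<Sum>u\<in>?T. real (g (v, u)))"
    using assms(1) by (intro sum_mono) (auto simp: is_flow_def)
  ultimately show ?thesis by linarith
qed

section \<open>Arcs indexed by numbers, and the graphs spanned by sets of indices\<close>

text \<open>
  \<open>sat i j\<close> says that the \<open>i\<close>-th partial assignment satisfies clause \<open>j\<close>, where \<open>i < N\<close> is an
  assignment of the first half of the variables and \<open>N \<le> i < 2 * N\<close> one of the second half.
  Nodes: source \<open>0\<close>, sink \<open>1\<close>, assignments \<open>2 + i\<close>, clauses \<open>2 + 2 * N + j\<close>, and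
  dead ends \<open>2 + 2 * N + k + j\<close>, whose arcs replace the missing ones, so that
  the number of arcs depends on \<open>N\<close> and \<open>k\<close> only.
\<close>

locale network =
  fixes N k :: nat and sat :: "nat \<Rightarrow> nat \<Rightarrow> bool"
  assumes N: "2 \<le> N"
begin

definition nbase :: nat where "nbase = 2 * N * k + N"

definition nedges :: nat where "nedges = N * (2 * k + 3)"

definition ends :: "nat \<Rightarrow> nat \<times> nat" where
  "ends x =
    (if x < 2 * N * k then
      (if sat (x div k) (x mod k) then (2 + x div k, 2 + 2 * N + k + x mod k)
       else if x div k < N then (2 + x div k, 2 + 2 * N + x mod k)
       else (2 + 2 * N + x mod k, 2 + x div k))
     else if x < nbase then (2 + N + (x - 2 * N * k), 1)
     else if x < nbase + N then (0, 2 + (x - nbase))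
     else (2 + (x - (nbase + N)), 1))"

text \<open>On clause arcs \<open>N\<close> acts as no restriction, since a left assignment never
  receives more than \<open>N\<close> units.\<close>

definition cap :: "nat \<Rightarrow> nat" where
  "cap x = (if 2 * N * k \<le> x \<and> x < nbase then 1 else N)"

text \<open>\<open>inv_into\<close> recovers the index of an arc from its endpoints, which relies on
  \<open>ends\<close> being injective below \<open>nedges\<close>.\<close>

definition gr :: "nat set \<Rightarrow> graph" where
  "gr X e = (if e \<in> ends ` X then cap (inv_into {..<nedges} ends e) else 0)"

lemma nedges: "nedges = nbase + 2 * N"
  by (simp add: nedges_def nbase_def algebra_simps)

text \<open>The number of arcs doubles as the number of nodes that is announced to the data
  structure. The first bound says that all node names fit; the surplus nodes are isolated.\<close>

lemma nedges_ge: "2 + 2 * N + 2 * k \<le> nedges" "2 \<le> nedges" "N \<le> nedges"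
proof -
  have "2 * (2 * k + 1) \<le> N * (2 * k + 1)" using N by (intro mult_le_mono1)
  then show "2 + 2 * N + 2 * k \<le> nedges" by (simp add: nedges_def algebra_simps)
  then show "2 \<le> nedges" "N \<le> nedges" by auto
qed

lemma div_mod_bounds:
  assumes "x < 2 * N * k"
  shows "x div k < 2 * N" "x mod k < k"
proof -
  have "0 < k" using assms by (cases k) auto
  then show "x div k < 2 * N" "x mod k < k"
    using assms by (auto simp: less_mult_imp_div_less)
qed

lemma index_bound: "i < 2 * N \<Longrightarrow> j < k \<Longrightarrow> i * k + j < 2 * N * k"
proof -
  assume "i < 2 * N" "j < k"
  then have "i * k + j < Suc i * k" by simp
  also have "\<dots> \<le> 2 * N * k" using \<open>i < 2 * N\<close> by (intro mult_le_mono1) simp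
  finally show ?thesis .
qed

lemma ends_index:
  assumes "i < 2 * N" "j < k"
  shows "ends (i * k + j) =
      (if sat i j then (2 + i, 2 + 2 * N + k + j)
       else if i < N then (2 + i, 2 + 2 * N + j) else (2 + 2 * N + j, 2 + i))"
    "cap (i * k + j) = N"
  using index_bound[OF assms] assms(2) by (auto simp: ends_def cap_def)

lemma ends_cases:
  assumes "x < nedges"
  obtains
    (clause) i j where "i < 2 * N" "j < k" "x = i * k + j" "x < 2 * N * k"
  | (right) l where "l < N" "x = 2 * N * k + l" "ends x = (2 + N + l, 1)" "cap x = 1" "x < nbase"
  | (source) i where "i < N" "x = nbase + i" "ends x = (0, 2 + i)" "cap x = N"
  | (sink) i where "i < N" "x = nbase + N + i" "ends x = (2 + i, 1)" "cap x = N"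
proof -
  consider "x < 2 * N * k" | "2 * N * k \<le> x" "x < nbase" | "nbase \<le> x" "x < nbase + N"
    | "nbase + N \<le> x" by linarith
  then show ?thesis
  proof cases
    case 1
    then show ?thesis using clause[of "x div k" "x mod k"] div_mod_bounds[OF 1] by auto
  next
    case 2
    then show ?thesis using right[of "x - 2 * N * k"] by (auto simp: ends_def cap_def nbase_def)
  next
    case 3
    then show ?thesis using source[of "x - nbase"] by (auto simp: ends_def cap_def nbase_def)
  next
    case 4
    then show ?thesis using sink[of "x - (nbase + N)"] assms
      by (auto simp: ends_def cap_def nbase_def nedges)
  qed
qed

lemma cap_bounds: "0 < cap x" "cap x \<le> N"
  using N by (auto simp: cap_def)

lemma ends_bounds:
  assumes "x < nedges"
  shows "fst (ends x) < nedges" "snd (ends x) < nedges" "fst (ends x) \<noteq> snd (ends x)"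
proof -
  have "fst (ends x) < nedges \<and> snd (ends x) < nedges \<and> fst (ends x) \<noteq> snd (ends x)"
    using assms
  proof (cases rule: ends_cases)
    case (clause i j)
    show ?thesis using ends_index[OF clause(1,2)] clause nedges_ge by auto
  qed (use nedges_ge N in auto)
  then show "fst (ends x) < nedges" "snd (ends x) < nedges" "fst (ends x) \<noteq> snd (ends x)"
    by auto
qed

text \<open>The groups of arcs differ in the kinds of their endpoints: only source arcs leave
  \<open>0\<close>, and the two groups entering \<open>1\<close> start in different halves.
  Injectivity makes every insertion hit an absent edge and makes the edge count equal to the index
  count.\<close>

lemma inj_on_ends: "inj_on ends {..<nedges}"
proof (rule inj_onI)
  fix x y
  assume xy: "x \<in> {..<nedges}" "y \<in> {..<nedges}" "ends x = ends y"
  have "x < nedges" "y < nedges" using xy by auto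
  then show "x = y"
  proof (cases rule: ends_cases[case_product ends_cases])
    case (clause_clause i j i' j')
    show ?thesis
      using xy(3) clause_clause ends_index[OF clause_clause(1,2)] ends_index[OF clause_clause(5,6)]
      by (auto split: if_splits)
  next
    case (clause_right i j l)
    show ?thesis using xy(3) clause_right ends_index[OF clause_right(1,2)] by (auto split: if_splits)
  next
    case (clause_source i j l)
    show ?thesis using xy(3) clause_source ends_index[OF clause_source(1,2)] by (auto split: if_splits)
  next
    case (clause_sink i j l)
    show ?thesis using xy(3) clause_sink ends_index[OF clause_sink(1,2)] by (auto split: if_splits)
  next
    case (right_clause l i j)
    show ?thesis using xy(3) right_clause ends_index[of i j] by (auto split: if_splits)
  next
    case (source_clause l i j)
    show ?thesis using xy(3) source_clause ends_index[of i j] by (auto split: if_splits)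
  next
    case (sink_clause l i j)
    show ?thesis using xy(3) sink_clause ends_index[of i j] by (auto split: if_splits)
  qed (use xy(3) in auto)
qed

lemma gr_ends:
  assumes "X \<subseteq> {..<nedges}" "x < nedges"
  shows "gr X (ends x) = (if x \<in> X then cap x else 0)"
  using assms inj_on_image_mem_iff[OF inj_on_ends, of x X] inv_into_f_f[OF inj_on_ends, of x]
  by (auto simp: gr_def)

lemma gr_posE:
  assumes "X \<subseteq> {..<nedges}" "gr X e \<noteq> 0"
  obtains x where "x \<in> X" "x < nedges" "e = ends x" "gr X e = cap x"
proof -
  obtain x where x: "x \<in> X" "e = ends x" using assms(2) by (auto simp: gr_def split: if_splits)
  then have "x < nedges" using assms(1) by auto
  then show thesis using that gr_ends[OF assms(1)] x by auto
qed

lemma gr_insert: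
  assumes "X \<subseteq> {..<nedges}" "x < nedges"
  shows "gr (insert x X) = (gr X)(ends x := cap x)"
  using inv_into_f_f[OF inj_on_ends, of x] assms(2) by (simp add: gr_def fun_eq_iff)

lemma gr_remove:
  assumes "X \<subseteq> {..<nedges}" "x < nedges"
  shows "gr (X - {x}) = (gr X)(ends x := 0)"
proof
  fix e
  have "X - {x} \<subseteq> {..<nedges}" using assms by auto
  then have "ends x \<notin> ends ` (X - {x})"
    using inj_on_image_mem_iff[OF inj_on_ends, of x "X - {x}"] assms by auto
  then show "gr (X - {x}) e = ((gr X)(ends x := 0)) e"
    by (auto simp: gr_def)
qed

lemma card_edges_gr:
  assumes "X \<subseteq> {..<nedges}"
  shows "card (edges (gr X)) = card X"
proof -
  have "0 < gr X e \<longleftrightarrow> e \<in> ends ` X" for e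
    using cap_bounds(1) by (simp add: gr_def)
  then have "edges (gr X) = ends ` X" by (auto simp: edges_def)
  then show ?thesis using card_image[of ends X] inj_on_subset[OF inj_on_ends assms] by simp
qed

section \<open>The maximum flow at the query for one left assignment\<close>

definition stage :: "nat set \<Rightarrow> nat \<Rightarrow> nat set" where
  "stage I i = {..<nbase} \<union> (+) nbase ` insert i I \<union> (+) (nbase + N) ` I"

lemma stage_bound: "I \<subseteq> {..<N} \<Longrightarrow> i < N \<Longrightarrow> stage I i \<subseteq> {..<nedges}"
  using N by (auto simp: stage_def nedges)

text \<open>The witness \<open>j\<close> is both a clause falsified by the combined assignment and
  the middle of a path from \<open>i\<close> to the right assignment \<open>l\<close>.\<close>

definition blocked :: "nat \<Rightarrow> nat \<Rightarrow> bool" where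
  "blocked i l \<longleftrightarrow> (\<exists>j<k. \<not> sat i j \<and> \<not> sat (N + l) j)"

text \<open>
  The assignments in \<open>I\<close> send their \<open>N\<close> units directly to the sink, which leaves all units of
  capacity behind the second half to the assignment \<open>i\<close>.
\<close>

context
  fixes I :: "nat set" and i :: nat
  assumes I: "I \<subseteq> {..<N}" "i < N" "i \<notin> I"
begin

lemma stage_posE:
  assumes "gr (stage I i) (u, v) \<noteq> 0"
  obtains
    (dead) i' j where "u = 2 + i'" "v = 2 + 2 * N + k + j" "j < k"
  | (left) i' j where "i' < N" "j < k" "\<not> sat i' j" "u = 2 + i'" "v = 2 + 2 * N + j"
  | (clause) l j where "l < N" "j < k" "\<not> sat (N + l) j" "u = 2 + 2 * N + j" "v = 2 + N + l"
  | (right) l where "l < N" "u = 2 + N + l" "v = 1" "gr (stage I i) (u, v) = 1"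
  | (source) i' where "i' \<in> insert i I" "u = 0" "v = 2 + i'" "gr (stage I i) (u, v) = N"
  | (sink) i' where "i' \<in> I" "u = 2 + i'" "v = 1" "gr (stage I i) (u, v) = N"
proof -
  obtain x where x: "x \<in> stage I i" "x < nedges" "(u, v) = ends x" "gr (stage I i) (u, v) = cap x"
    using gr_posE[OF stage_bound[OF I(1,2)] assms] .
  from x(2) show thesis
  proof (cases rule: ends_cases)
    case (clause i' j)
    note e = ends_index[OF clause(1,2)]
    show ?thesis
    proof (cases "sat i' j")
      case True
      then show ?thesis using dead[of i' j] e x(3) clause by simp
    next
      case False
      note F = this
      show ?thesis
      proof (cases "i' < N")
        case True
        then show ?thesis using left[of i' j] e x(3) clause F by simp
      next
        case False
        have "N + (i' - N) = i'" using False by simp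
        then show ?thesis using that(3)[of "i' - N" j] e x(3) clause False F by auto
      qed
    qed
  next
    case (right l)
    then show ?thesis using that(4)[of l] x by simp
  next
    case (source i')
    then have "i' \<in> insert i I" using x(1) I by (auto simp: stage_def)
    then show ?thesis using that(5)[of i'] x source by simp
  next
    case (sink i')
    then have "i' \<in> I" using x(1) I by (auto simp: stage_def)
    then show ?thesis using that(6)[of i'] x sink by simp
  qed
qed

text \<open>The cut bound in the only form needed: all positive arcs leaving \<open>S\<close> are
  source arcs, of capacity \<open>N\<close>, or unit arcs of right assignments, so counting them
  suffices.\<close>

lemma flow_le_arcs:
  assumes "is_flow nedges (gr (stage I i)) 0 1 f" "S \<subseteq> {..<nedges}" "0 \<in> S" "1 \<notin> S"
    and R: "A \<subseteq> insert i I" "R \<subseteq> {..<N}"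
    and cut: "\<And>u v. u \<in> S \<Longrightarrow> v \<notin> S \<Longrightarrow> gr (stage I i) (u, v) \<noteq> 0 \<Longrightarrow>
      (\<exists>a\<in>A. u = 0 \<and> v = 2 + a) \<or> (\<exists>l\<in>R. u = 2 + N + l \<and> v = 1)"
  shows "flow_value nedges 0 f \<le> real N * real (card A) + real (card R)"
proof -
  let ?g = "gr (stage I i)"
  \<comment> \<open>\<open>h\<close> dominates the capacities across the cut and is a sum of single
    arcs. It can therefore be summed over all pairs of nodes, where each arc contributes
    once.\<close>
  define h where "h u v = real N * (\<Sum>a\<in>A. arc 0 (2 + a) u v) + (\<Sum>l\<in>R. arc (2 + N + l) 1 u v)"
    for u v
  have fin: "finite A" "finite R" using R I finite_subset[of I] finite_subset[of R]
    by (auto intro: finite_subset)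
  have A: "A \<subseteq> {..<N}" using R I by auto
  have h0: "0 \<le> h u v" for u v
    by (auto simp: h_def arc_nonneg intro!: add_nonneg_nonneg mult_nonneg_nonneg sum_nonneg)
  have gh: "real (?g (u, v)) \<le> h u v" if uv: "u \<in> S" "v \<notin> S" for u v
  proof (cases "?g (u, v) = 0")
    case False
    from cut[OF uv False] show ?thesis
    proof (elim disjE bexE conjE)
      fix a assume a: "a \<in> A" "u = 0" "v = 2 + a"
      have "?g (u, v) = N" using False a by (cases rule: stage_posE) auto
      moreover have "1 \<le> (\<Sum>a\<in>A. arc 0 (2 + a) u v)"
        using a member_le_sum[OF a(1), of "\<lambda>a. arc 0 (2 + a) u v"] fin
        by (auto simp: arc_nonneg) (simp add: arc_def)
      moreover have "0 \<le> (\<Sum>l\<in>R. arc (2 + N + l) 1 u v)" by (simp add: sum_nonneg arc_nonneg)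
      ultimately show ?thesis
        using mult_left_mono[of 1 "\<Sum>a\<in>A. arc 0 (2 + a) u v" "real N"] by (simp add: h_def)
    next
      fix l assume l: "l \<in> R" "u = 2 + N + l" "v = 1"
      have "?g (u, v) = 1" using False I by (cases rule: stage_posE) (use l in auto)
      moreover have "1 \<le> (\<Sum>l\<in>R. arc (2 + N + l) 1 u v)"
        using l member_le_sum[OF l(1), of "\<lambda>l. arc (2 + N + l) 1 u v"] fin
        by (auto simp: arc_nonneg) (simp add: arc_def)
      moreover have "0 \<le> real N * (\<Sum>a\<in>A. arc 0 (2 + a) u v)" by (simp add: sum_nonneg arc_nonneg)
      ultimately show ?thesis by (simp add: h_def)
    qed
  qed (simp add: h0)
  have "flow_value nedges 0 f \<le> (\<Sum>u\<in>S. \<Sum>v\<in>{..<nedges} - S. real (?g (u, v)))"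
    using flow_value_le_cut[OF assms(1-4)] .
  also have "\<dots> \<le> (\<Sum>u\<in>S. \<Sum>v\<in>{..<nedges} - S. h u v)"
    using gh by (intro sum_mono) auto
  also have "\<dots> \<le> (\<Sum>u\<in>S. \<Sum>v<nedges. h u v)"
    using h0 by (intro sum_mono sum_mono2) auto
  also have "\<dots> \<le> (\<Sum>u<nedges. \<Sum>v<nedges. h u v)"
    using h0 assms(2) by (intro sum_mono2 sum_nonneg) auto
  also have "\<dots> = real N * (\<Sum>u<nedges. \<Sum>v<nedges. \<Sum>a\<in>A. arc 0 (2 + a) u v)
      + (\<Sum>u<nedges. \<Sum>v<nedges. \<Sum>l\<in>R. arc (2 + N + l) 1 u v)"
    unfolding h_def sum.distrib sum_distrib_left ..
  also have "\<dots> = real N * real (card A) + real (card R)"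
    using fin A R(2) nedges_ge N
    by (subst (1 2) sum_sum_arcs) (auto dest!: subsetD)
  finally show ?thesis .
qed

lemma finite_I: "finite I"
  using I(1) finite_subset by blast

lemma flow_le_full:
  assumes "is_flow nedges (gr (stage I i)) 0 1 f"
  shows "flow_value nedges 0 f \<le> real N * (real (card I) + 1)"
proof -
  have "flow_value nedges 0 f \<le> real N * real (card (insert i I)) + real (card ({} :: nat set))"
  proof (rule flow_le_arcs[OF assms, of "{0}"])
    fix u v assume "u \<in> {0::nat}" "v \<notin> {0::nat}" "gr (stage I i) (u, v) \<noteq> 0"
    from this(3,1) show "(\<exists>a\<in>insert i I. u = 0 \<and> v = 2 + a) \<or> (\<exists>l\<in>{}. u = 2 + N + l \<and> v = 1)"
      by (cases rule: stage_posE) auto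
  qed (use nedges_ge in auto)
  then show ?thesis using finite_I I(3) by (simp add: algebra_simps)
qed

text \<open>The source side of the cut is everything that \<open>i\<close> can reach, all dead ends,
  and all right assignments except \<open>l0\<close>. No clause missed by \<open>i\<close> leads to
  \<open>l0\<close>, so only the source arcs into \<open>I\<close> and \<open>N - 1\<close> unit
  arcs cross. The dead ends must be on this side because arcs of capacity \<open>N\<close> enter
  them.\<close>

lemma flow_less_full:
  assumes "is_flow nedges (gr (stage I i)) 0 1 f" "l0 < N" "\<not> blocked i l0"
  shows "flow_value nedges 0 f < real N * (real (card I) + 1)"
proof -
  let ?R = "{..<N} - {l0}"
  define S where "S = {0, 2 + i} \<union> {2 + 2 * N + j | j. j < k \<and> \<not> sat i j} \<union>
    {2 + 2 * N + k + j | j. j < k} \<union> (+) (2 + N) ` ?R"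
  have "flow_value nedges 0 f \<le> real N * real (card I) + real (card ?R)"
  proof (rule flow_le_arcs[OF assms(1), of S])
    show "S \<subseteq> {..<nedges}" using nedges_ge I N by (auto simp: S_def)
    fix u v assume uv: "u \<in> S" "v \<notin> S" "gr (stage I i) (u, v) \<noteq> 0"
    from uv(3) show "(\<exists>a\<in>I. u = 0 \<and> v = 2 + a) \<or> (\<exists>l\<in>?R. u = 2 + N + l \<and> v = 1)"
    proof (cases rule: stage_posE)
      case (dead i' j)
      then show ?thesis using uv by (auto simp: S_def)
    next
      case (left i' j)
      then show ?thesis using uv I by (auto simp: S_def)
    next
      case (clause l j)
      then have "\<not> sat i j" using uv(1) I by (auto simp: S_def)
      then have "l \<noteq> l0" using clause assms(3) by (auto simp: blocked_def)
      then show ?thesis using uv clause by (auto simp: S_def)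
    next
      case (right l)
      then show ?thesis using uv I by (auto simp: S_def)
    next
      case (source i')
      then show ?thesis using uv I by (auto simp: S_def)
    next
      case (sink i')
      then show ?thesis using uv I by (auto simp: S_def)
    qed
  qed (auto simp: S_def)
  moreover have "card ?R = N - 1" using assms(2) by simp
  ultimately show ?thesis using N by (simp add: algebra_simps of_nat_diff)
qed

text \<open>A superposition of paths: \<open>N\<close> units from the source through each assignment
  in \<open>I\<close> straight to the sink, and for every \<open>l\<close> one unit through
  \<open>i\<close>, a clause \<open>\<phi> l\<close> missed by both \<open>i\<close> and
  \<open>l\<close>, and \<open>l\<close>.\<close>

lemma full_flow_exists:
  assumes "\<forall>l<N. blocked i l"
  shows "\<exists>f. is_flow nedges (gr (stage I i)) 0 1 f \<and> flow_value nedges 0 f = real N * (real (card I) + 1)"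
proof -
  let ?g = "gr (stage I i)" and ?n = nedges
  obtain \<phi> where \<phi>: "\<And>l. l < N \<Longrightarrow> \<phi> l < k \<and> \<not> sat i (\<phi> l) \<and> \<not> sat (N + l) (\<phi> l)"
    using assms unfolding blocked_def by metis
  let ?c = "\<lambda>l. 2 + 2 * N + \<phi> l"
  define f1 where "f1 u v = (\<Sum>a\<in>I. arc 0 (2 + a) u v + arc (2 + a) 1 u v)" for u v
  define f2 where "f2 u v = (\<Sum>l<N. arc 0 (2 + i) u v + arc (2 + i) (?c l) u v
      + arc (?c l) (2 + N + l) u v + arc (2 + N + l) 1 u v)" for u v
  define f where "f e = real N * f1 (fst e) (snd e) + f2 (fst e) (snd e)" for e
  have lt: "0 < ?n" "1 < ?n" "2 + i < ?n" "\<And>a. a \<in> I \<Longrightarrow> 2 + a < ?n"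
    "\<And>l. l < N \<Longrightarrow> ?c l < ?n" "\<And>l. l < N \<Longrightarrow> 2 + N + l < ?n"
    using nedges_ge I \<phi> by (auto dest!: subsetD dest: less_imp_le intro: le_less_trans) force+
  \<comment> \<open>Listing the heads of the arcs path by path here, and their tails below, makes
    conservation a termwise identity away from \<open>0\<close> and \<open>1\<close>.\<close>
  have inflow: "(\<Sum>u<?n. f (u, v)) = real N * (\<Sum>a\<in>I. of_bool (v = 2 + a) + of_bool (v = 1))
      + (\<Sum>l<N. of_bool (v = 2 + i) + of_bool (v = ?c l) + of_bool (v = 2 + N + l) + of_bool (v = 1))"
    for v
  proof -
    have "(\<Sum>u<?n. f (u, v)) = real N * (\<Sum>a\<in>I. (\<Sum>u<?n. arc 0 (2 + a) u v) + (\<Sum>u<?n. arc (2 + a) 1 u v))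
      + (\<Sum>l<N. (\<Sum>u<?n. arc 0 (2 + i) u v) + (\<Sum>u<?n. arc (2 + i) (?c l) u v)
        + (\<Sum>u<?n. arc (?c l) (2 + N + l) u v) + (\<Sum>u<?n. arc (2 + N + l) 1 u v))"
      unfolding f_def f1_def f2_def fst_conv snd_conv sum.distrib sum_distrib_left[symmetric]
      by (subst (1 2 3 4 5 6) sum.swap) simp
    also have "\<dots> = real N * (\<Sum>a\<in>I. of_bool (v = 2 + a) + of_bool (v = 1))
      + (\<Sum>l<N. of_bool (v = 2 + i) + of_bool (v = ?c l) + of_bool (v = 2 + N + l) + of_bool (v = 1))"
      using lt by (intro arg_cong2[where f = "(+)"] arg_cong2[where f = "(*)"] sum.cong refl sum_arc_in) auto
    finally show ?thesis .
  qed
  have outflow: "(\<Sum>u<?n. f (v, u)) = real N * (\<Sum>a\<in>I. of_bool (v = 0) + of_bool (v = 2 + a))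
      + (\<Sum>l<N. of_bool (v = 0) + of_bool (v = 2 + i) + of_bool (v = ?c l) + of_bool (v = 2 + N + l))"
    for v
  proof -
    have "(\<Sum>u<?n. f (v, u)) = real N * (\<Sum>a\<in>I. (\<Sum>u<?n. arc 0 (2 + a) v u) + (\<Sum>u<?n. arc (2 + a) 1 v u))
      + (\<Sum>l<N. (\<Sum>u<?n. arc 0 (2 + i) v u) + (\<Sum>u<?n. arc (2 + i) (?c l) v u)
        + (\<Sum>u<?n. arc (?c l) (2 + N + l) v u) + (\<Sum>u<?n. arc (2 + N + l) 1 v u))"
      unfolding f_def f1_def f2_def fst_conv snd_conv sum.distrib sum_distrib_left[symmetric]
      by (subst (1 2 3 4 5 6) sum.swap) simp
    also have "\<dots> = real N * (\<Sum>a\<in>I. of_bool (v = 0) + of_bool (v = 2 + a))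
      + (\<Sum>l<N. of_bool (v = 0) + of_bool (v = 2 + i) + of_bool (v = ?c l) + of_bool (v = 2 + N + l))"
      using lt by (intro arg_cong2[where f = "(+)"] arg_cong2[where f = "(*)"] sum.cong refl sum_arc_out) auto
    finally show ?thesis .
  qed
  have val: "flow_value ?n 0 f = real N * (real (card I) + 1)"
    unfolding flow_value_def inflow outflow by (simp add: algebra_simps)
  have nonneg: "0 \<le> f e" for e
    by (auto simp: f_def f1_def f2_def arc_nonneg
        intro!: add_nonneg_nonneg mult_nonneg_nonneg sum_nonneg)
  have cap: "f (u, v) \<le> real (?g (u, v))" for u v
  proof -
    have g: "?g (ends x) = (if x \<in> stage I i then cap x else 0)" if "x < nedges" for x
      using gr_ends[OF stage_bound[OF I(1,2)] that] .
    have gsource: "?g (0, 2 + a) = N" if "a \<in> insert i I" for a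
    proof -
      have "a < N" using that I by auto
      then show ?thesis using g[of "nbase + a"] that
        by (auto simp: nedges ends_def cap_def nbase_def stage_def)
    qed
    have gsink: "?g (2 + a, 1) = N" if "a \<in> I" for a
    proof -
      have "a < N" using that I by auto
      then show ?thesis using g[of "nbase + N + a"] that
        by (auto simp: nedges ends_def cap_def nbase_def stage_def)
    qed
    have gright: "?g (2 + N + l, 1) = 1" if "l < N" for l
      using g[of "2 * N * k + l"] that
      by (auto simp: nedges ends_def cap_def nbase_def stage_def)
    have gleft: "?g (2 + i, ?c l) = N" if "l < N" for l
      using g[of "i * k + \<phi> l"] \<phi>[OF that] I index_bound[of i "\<phi> l"] ends_index[of i "\<phi> l"]
      by (auto simp: nedges nbase_def stage_def)
    have gclause: "?g (?c l, 2 + N + l) = N" if "l < N" for l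
      using g[of "(N + l) * k + \<phi> l"] \<phi>[OF that] that index_bound[of "N + l" "\<phi> l"]
        ends_index[of "N + l" "\<phi> l"]
      by (auto simp: nedges nbase_def stage_def)
    have f1: "f1 u v = of_bool (u = 0 \<and> (\<exists>a\<in>I. v = 2 + a)) + of_bool (v = 1 \<and> (\<exists>a\<in>I. u = 2 + a))"
    proof -
      have "(\<Sum>a\<in>I. arc 0 (2 + a) u v) = (\<Sum>a\<in>I. if a = v - 2 then of_bool (u = 0 \<and> 2 \<le> v) else 0)"
        by (intro sum.cong refl) (auto simp: arc_def)
      moreover have "(\<Sum>a\<in>I. arc (2 + a) 1 u v) = (\<Sum>a\<in>I. if a = u - 2 then of_bool (v = 1 \<and> 2 \<le> u) else 0)"
        by (intro sum.cong refl) (auto simp: arc_def)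
      moreover have "(\<exists>a\<in>I. v = 2 + a) \<longleftrightarrow> 2 \<le> v \<and> v - 2 \<in> I" for v
        by (auto intro: bexI[of _ "v - 2"])
      ultimately show ?thesis
        unfolding f1_def sum.distrib by (simp add: finite_I)
    qed
    have split: "f2 u v = (\<Sum>l<N. arc 0 (2 + i) u v) + (\<Sum>l<N. arc (2 + i) (?c l) u v)
      + (\<Sum>l<N. arc (?c l) (2 + N + l) u v) + (\<Sum>l<N. arc (2 + N + l) 1 u v)"
      unfolding f2_def sum.distrib ..
    have s1: "(\<Sum>l<N. arc 0 (2 + i) u v) = real N * of_bool (u = 0 \<and> v = 2 + i)"
      by (simp add: arc_def)
    \<comment> \<open>All \<open>N\<close> paths may choose the same clause, so the arc from
      \<open>i\<close> to it can carry \<open>N\<close> units; beyond the clause the paths separate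
      again.\<close>
    have s2: "(\<Sum>l<N. arc (2 + i) (?c l) u v) \<le> real N * of_bool (u = 2 + i \<and> (\<exists>l<N. v = ?c l))"
    proof -
      have "(\<Sum>l<N. arc (2 + i) (?c l) u v) \<le> (\<Sum>l<N. of_bool (u = 2 + i \<and> (\<exists>l<N. v = ?c l)))"
        by (intro sum_mono) (auto simp: arc_def)
      then show ?thesis by simp
    qed
    have s3: "(\<Sum>l<N. arc (?c l) (2 + N + l) u v) \<le> of_bool (\<exists>l<N. u = ?c l \<and> v = 2 + N + l)"
    proof -
      have "(\<Sum>l<N. arc (?c l) (2 + N + l) u v) \<le> (\<Sum>l<N. if l = v - (2 + N)
          then of_bool (\<exists>l<N. u = ?c l \<and> v = 2 + N + l) else 0)"
        by (intro sum_mono) (auto simp: arc_def)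
      also have "\<dots> \<le> of_bool (\<exists>l<N. u = ?c l \<and> v = 2 + N + l)" by (subst sum.delta) auto
      finally show ?thesis .
    qed
    have s4: "(\<Sum>l<N. arc (2 + N + l) 1 u v) \<le> of_bool (v = 1 \<and> (\<exists>l<N. u = 2 + N + l))"
    proof -
      have "(\<Sum>l<N. arc (2 + N + l) 1 u v) \<le> (\<Sum>l<N. if l = u - (2 + N)
          then of_bool (v = 1 \<and> (\<exists>l<N. u = 2 + N + l)) else 0)"
        by (intro sum_mono) (auto simp: arc_def)
      also have "\<dots> \<le> of_bool (v = 1 \<and> (\<exists>l<N. u = 2 + N + l))" by (subst sum.delta) auto
      finally show ?thesis .
    qed
    have le: "f (u, v) \<le> real N * (of_bool (u = 0 \<and> (\<exists>a\<in>I. v = 2 + a)) + of_bool (v = 1 \<and> (\<exists>a\<in>I. u = 2 + a)))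
      + real N * of_bool (u = 0 \<and> v = 2 + i) + real N * of_bool (u = 2 + i \<and> (\<exists>l<N. v = ?c l))
      + of_bool (\<exists>l<N. u = ?c l \<and> v = 2 + N + l) + of_bool (v = 1 \<and> (\<exists>l<N. u = 2 + N + l))"
      unfolding f_def fst_conv snd_conv f1 split using s1 s2 s3 s4 by linarith
    \<comment> \<open>The groups of arcs are disjoint, so in each case one indicator in
      \<open>le\<close> survives and is matched by the capacity of that arc.\<close>
    consider (source) a where "a \<in> I" "u = 0" "v = 2 + a" | (sink) a where "a \<in> I" "u = 2 + a" "v = 1"
      | (first) "u = 0" "v = 2 + i" | (left) l where "l < N" "u = 2 + i" "v = ?c l"
      | (clause) l where "l < N" "u = ?c l" "v = 2 + N + l" | (right) l where "l < N" "u = 2 + N + l" "v = 1"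
      | (none) "\<not> (u = 0 \<and> (\<exists>a\<in>I. v = 2 + a))" "\<not> (v = 1 \<and> (\<exists>a\<in>I. u = 2 + a))"
        "\<not> (u = 0 \<and> v = 2 + i)" "\<not> (u = 2 + i \<and> (\<exists>l<N. v = ?c l))"
        "\<not> (\<exists>l<N. u = ?c l \<and> v = 2 + N + l)" "\<not> (v = 1 \<and> (\<exists>l<N. u = 2 + N + l))"
      by blast
    then show ?thesis
    proof cases
      case source
      then show ?thesis using le gsource[of a] I by (cases "a = i") auto
    next
      case sink
      then show ?thesis using le gsink[of a] I by (auto dest!: subsetD)
    next
      case first
      then show ?thesis using le gsource[of i] I by auto
    next
      case left
      then show ?thesis using le gleft[of l] I by (auto simp: of_bool_def split: if_splits)
    next
      case clause
      then show ?thesis using le gclause[of l] I N by (auto simp: of_bool_def split: if_splits)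
    next
      case right
      then show ?thesis using le gright[of l] I by (auto simp: of_bool_def split: if_splits)
    next
      case none
      then show ?thesis using le by (simp only: of_bool_eq) simp
    qed
  qed
  have "is_flow ?n ?g 0 1 f"
    unfolding is_flow_def
  proof (intro conjI allI impI)
    show "0 \<le> f e" for e by (rule nonneg)
    show "f e \<le> real (?g e)" for e using cap[of "fst e" "snd e"] by simp
    show "(\<Sum>u<?n. f (u, v)) = (\<Sum>u<?n. f (v, u))" if "v < ?n" "v \<noteq> 0 \<and> v \<noteq> 1" for v
      using that unfolding inflow outflow by simp
  qed
  then show ?thesis using val by blast
qed

lemma max_flow_value_full_iff:
  assumes "is_max_flow_value nedges (gr (stage I i)) 0 1 r"
  shows "r = real N * (real (card I) + 1) \<longleftrightarrow> (\<forall>l<N. blocked i l)"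
    "r \<le> real N * (real (card I) + 1)"
proof -
  obtain f where f: "is_flow nedges (gr (stage I i)) 0 1 f" "flow_value nedges 0 f = r"
    using assms by (auto simp: is_max_flow_value_def)
  show le: "r \<le> real N * (real (card I) + 1)" using flow_le_full[OF f(1)] f(2) by simp
  show "r = real N * (real (card I) + 1) \<longleftrightarrow> (\<forall>l<N. blocked i l)"
  proof
    assume "r = real N * (real (card I) + 1)"
    then show "\<forall>l<N. blocked i l" using flow_less_full[OF f(1)] f(2) by fastforce
  next
    assume "\<forall>l<N. blocked i l"
    then have "real N * (real (card I) + 1) \<le> r"
      using full_flow_exists assms by (auto simp: is_max_flow_value_def)
    then show "r = real N * (real (card I) + 1)" using le by simp
  qed
qed

end

end

section \<open>The sequences of operations\<close>

context network
begin

definition insert_op :: "nat \<Rightarrow> operation" where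
  "insert_op x = Insert (fst (ends x)) (snd (ends x)) (cap x)"

definition delete_op :: "nat \<Rightarrow> operation" where
  "delete_op x = Delete (fst (ends x)) (snd (ends x))"

text \<open>
  The flag \<open>d\<close> distinguishes the decremental from the incremental sequence. Both end with
  three operations for each assignment \<open>i\<close> of the first half, the second of which is a query.
\<close>

definition ninit :: "bool \<Rightarrow> nat" where
  "ninit d = (if d then nedges else nbase)"

definition nops :: "bool \<Rightarrow> nat" where
  "nops d = ninit d + 3 * N"

definition operation :: "bool \<Rightarrow> nat \<Rightarrow> operation" where
  "operation d x =
    (if x < ninit d then insert_op x
     else let i = (x - ninit d) div 3; r = (x - ninit d) mod 3 in
       if r = 1 then Query
       else if d then delete_op (if r = 0 then nbase + N + i else nbase + i)
       else insert_op (if r = 0 then nbase + i else nbase + N + i))"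

text \<open>Indices of the arcs that exist just before operation \<open>x\<close>. Stage
  \<open>i\<close> changes one arc by its operation \<open>3 * i\<close> and the other by
  \<open>3 * i + 2\<close>. Insertions treat the source arc first, deletions the arc to the sink, so
  the thresholds swap.\<close>

definition present :: "bool \<Rightarrow> nat \<Rightarrow> nat set" where
  "present d x =
    (if x < ninit d then {..<x}
     else if d then {..<nbase} \<union> (+) nbase ` {i. i < N \<and> x - ninit d \<le> 3 * i + 2}
       \<union> (+) (nbase + N) ` {i. i < N \<and> x - ninit d \<le> 3 * i}
     else {..<nbase} \<union> (+) nbase ` {i. 3 * i < x - ninit d}
       \<union> (+) (nbase + N) ` {i. 3 * i + 2 < x - ninit d})"

text \<open>The assignments absorbed by their direct arcs at query \<open>i\<close>: those already
  done when inserting, those still to come when deleting.\<close>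

definition others :: "bool \<Rightarrow> nat \<Rightarrow> nat set" where
  "others d i = (if d then {i<..<N} else {..<i})"

definition full :: "bool \<Rightarrow> nat \<Rightarrow> nat" where
  "full d x = (let i = (x - ninit d) div 3 in N * (if d then N - i else i + 1))"

definition ops :: "bool \<Rightarrow> operation list" where
  "ops d = map (operation d) [0..<nops d]"

lemma length_ops [simp]: "length (ops d) = nops d"
  by (simp add: ops_def)

lemma nth_ops: "x < nops d \<Longrightarrow> ops d ! x = operation d x"
  by (simp add: ops_def)

lemma ops_cases:
  assumes "x < nops d"
  obtains (init) "x < ninit d" "operation d x = insert_op x"
  | (stage) i r where "i < N" "r < 3" "x = ninit d + 3 * i + r"
proof (cases "x < ninit d")
  case True
  then show ?thesis using init by (simp add: operation_def)
next
  case False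
  then have "(x - ninit d) div 3 < N" using assms by (auto simp: nops_def)
  then show ?thesis using False stage[of "(x - ninit d) div 3" "(x - ninit d) mod 3"] by simp
qed

lemma operation_stage:
  assumes "r < 3"
  shows "operation d (ninit d + 3 * i + r) =
      (if r = 1 then Query
       else if d then delete_op (if r = 0 then nbase + N + i else nbase + i)
       else insert_op (if r = 0 then nbase + i else nbase + N + i))"
proof -
  have "(3 * i + r) div 3 = i" "(3 * i + r) mod 3 = r" using assms by auto
  then show ?thesis by (simp add: operation_def Let_def add.assoc)
qed

lemma lessThan_nedges:
  "{..<nedges} = {..<nbase} \<union> (+) nbase ` {..<N} \<union> (+) (nbase + N) ` {..<N}"
  unfolding lessThan_atLeast0 image_add_atLeastLessThan by (auto simp: nedges)

lemma present_ninit: "present d (ninit d) = {..<ninit d}"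
proof -
  have "{i. i < N \<and> 0 \<le> 3 * i + 2} = {..<N}" "{i. i < N \<and> 0 \<le> 3 * i} = {..<N}" by auto
  then show ?thesis by (simp add: present_def ninit_def lessThan_nedges)
qed

lemma present_subset: "x \<le> nops d \<Longrightarrow> present d x \<subseteq> {..<nedges}"
  using N by (auto simp: present_def ninit_def nops_def nedges)

lemma present_stage:
  "present d (ninit d + y) =
    (if d then {..<nbase} \<union> (+) nbase ` {i. i < N \<and> y \<le> 3 * i + 2}
       \<union> (+) (nbase + N) ` {i. i < N \<and> y \<le> 3 * i}
     else {..<nbase} \<union> (+) nbase ` {i. 3 * i < y} \<union> (+) (nbase + N) ` {i. 3 * i + 2 < y})"
  by (simp add: present_def)

text \<open>The value \<open>r = 3\<close> is allowed so that the same formula describes the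
  situation after the last operation of the stage.\<close>

lemma present_stage_intervals:
  assumes "i < N" "r \<le> 3"
  shows "present d (ninit d + (3 * i + r)) =
    (if d then {..<nbase} \<union> {nbase + (if r = 3 then Suc i else i)..<nbase + N}
       \<union> {nbase + N + (if r = 0 then i else Suc i)..<nbase + N + N}
     else {..<nbase} \<union> {nbase..<nbase + (if r = 0 then i else Suc i)}
       \<union> {nbase + N..<nbase + N + (if r = 3 then Suc i else i)})"
proof -
  have 1: "{j. j < N \<and> 3 * i + r \<le> 3 * j + 2} = {(if r = 3 then Suc i else i)..<N}"
    and 2: "{j. j < N \<and> 3 * i + r \<le> 3 * j} = {(if r = 0 then i else Suc i)..<N}"
    and 3: "{j. 3 * j < 3 * i + r} = {0..<(if r = 0 then i else Suc i)}"
    and 4: "{j. 3 * j + 2 < 3 * i + r} = {0..<(if r = 3 then Suc i else i)}"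
    using assms by auto
  show ?thesis
    unfolding present_stage 1 2 3 4 image_add_atLeastLessThan by (simp add: ac_simps)
qed

lemma present_query:
  assumes "i < N"
  shows "present d (ninit d + 3 * i + 1) = stage (others d i) i"
proof -
  have 1: "{j. j < N \<and> Suc (3 * i) \<le> 3 * j + 2} = insert i {i<..<N}"
    and 2: "{j. j < N \<and> Suc (3 * i) \<le> 3 * j} = {i<..<N}"
    and 3: "{j. 3 * j < Suc (3 * i)} = insert i {..<i}"
    and 4: "{j. 3 * j + 2 < Suc (3 * i)} = {..<i}"
    using assms by auto
  show ?thesis
    using present_stage[of d "3 * i + 1"] 1 2 3 4 by (simp add: stage_def others_def add.assoc)
qed

lemma others: "i < N \<Longrightarrow> others d i \<subseteq> {..<N} \<and> i \<notin> others d i \<and>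
    card (others d i) = (if d then N - Suc i else i)"
  by (auto simp: others_def)

text \<open>The invariant behind \<open>graph_after_ops\<close> and \<open>valid_ops\<close>: each
  operation adds an absent index, removes a present one, or is a query.\<close>

lemma operation_step:
  assumes x: "x < nops d" and w: "1 \<le> w"
  shows "gr (present d (Suc x)) = apply_op (operation d x) (gr (present d x)) \<and>
    valid_op nedges w (gr (present d x)) (operation d x)"
proof -
  have sub: "present d x \<subseteq> {..<nedges}" using present_subset x by simp
  have "nedges ^ 1 \<le> nedges ^ w" using w nedges_ge by (intro power_increasing) auto
  then have c: "cap y \<le> nedges ^ w" for y using cap_bounds[of y] nedges_ge by simp
  have ins: "gr (insert y (present d x)) = apply_op (insert_op y) (gr (present d x)) \<and>
      valid_op nedges w (gr (present d x)) (insert_op y)"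
    if "y < nedges" "y \<notin> present d x" for y
    using gr_insert[OF sub that(1)] gr_ends[OF sub that(1)] ends_bounds[OF that(1)] c cap_bounds that
    by (simp add: insert_op_def)
  have del: "gr (present d x - {y}) = apply_op (delete_op y) (gr (present d x)) \<and>
      valid_op nedges w (gr (present d x)) (delete_op y)"
    if "y < nedges" "y \<in> present d x" for y
    using gr_remove[OF sub that(1)] gr_ends[OF sub that(1)] cap_bounds that
    by (simp add: delete_op_def)
  from x show ?thesis
  proof (cases rule: ops_cases)
    case init
    have "present d (Suc x) = insert x (present d x)"
    \<comment> \<open>At the end of the initial phase the definition of \<open>present\<close>
      changes branch; \<open>present_ninit\<close> says that both branches agree there.\<close>
    proof (cases "Suc x = ninit d")
      case True
      then have "present d (Suc x) = {..<Suc x}" using present_ninit by simp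
      then show ?thesis using init by (simp add: present_def lessThan_Suc)
    next
      case False
      then have "Suc x < ninit d" using init by simp
      then show ?thesis by (simp add: present_def lessThan_Suc)
    qed
    moreover have "x \<notin> present d x" "x < nedges"
      using init by (simp_all add: present_def) (simp add: ninit_def nedges split: if_splits)
    ultimately show ?thesis using ins[of x] init by simp
  next
    case (stage i r)
    have lt: "nbase + i < nedges" "nbase + N + i < nedges" using stage(1) nedges by auto
    have now: "present d x = present d (ninit d + (3 * i + r))"
      and nxt: "present d (Suc x) = present d (ninit d + (3 * i + Suc r))"
      using stage by (simp_all add: add.assoc)
    note now = now[unfolded present_stage_intervals[OF stage(1) less_imp_le[OF stage(2)]]]
    note nxt = nxt[unfolded present_stage_intervals[OF stage(1) Suc_leI[OF stage(2)]]]
    consider "r = 0" | "r = 1" | "r = 2" using stage(2) by linarith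
    then show ?thesis
    proof cases
      case 1
      show ?thesis
      proof (cases d)
        case True
        have "nbase + N + i \<in> present d x"
          unfolding now using True 1 stage(1) by auto
        moreover have "present d (Suc x) = present d x - {nbase + N + i}"
          unfolding now nxt using True 1 stage(1) by auto
        ultimately show ?thesis
          using del[of "nbase + N + i"] lt stage operation_stage[OF stage(2)] True 1 by simp
      next
        case False
        have "nbase + i \<notin> present d x"
          unfolding now using False 1 stage(1) by auto
        moreover have "present d (Suc x) = insert (nbase + i) (present d x)"
          unfolding now nxt using False 1 stage(1) by auto
        ultimately show ?thesis
          using ins[of "nbase + i"] lt stage operation_stage[OF stage(2)] False 1 by simp
      qed
    next
      case 2
      have "present d (Suc x) = present d x"
        unfolding now nxt using 2 by simp
      then show ?thesis using operation_stage[OF stage(2)] stage(3) 2 by simp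
    next
      case 3
      show ?thesis
      proof (cases d)
        case True
        have "nbase + i \<in> present d x"
          unfolding now using True 3 stage(1) by auto
        moreover have "present d (Suc x) = present d x - {nbase + i}"
          unfolding now nxt using True 3 stage(1) by auto
        ultimately show ?thesis
          using del[of "nbase + i"] lt stage operation_stage[OF stage(2)] True 3 by simp
      next
        case False
        have "nbase + N + i \<notin> present d x"
          unfolding now using False 3 stage(1) by auto
        moreover have "present d (Suc x) = insert (nbase + N + i) (present d x)"
          unfolding now nxt using False 3 stage(1) by auto
        ultimately show ?thesis
          using ins[of "nbase + N + i"] lt stage operation_stage[OF stage(2)] False 3 by simp
      qed
    qed
  qed
qed

lemma graph_after_ops:
  assumes "x \<le> nops d"
  shows "graph_after (take x (ops d)) = gr (present d x)"
  using assms
proof (induction x)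
  case 0
  have "present d 0 = {}"
    using N present_ninit[of d] by (simp add: present_def ninit_def nedges nbase_def)
  then show ?case by (simp add: graph_after_def gr_def)
next
  case (Suc x)
  then show ?case using operation_step[of x d 1] nth_ops[of x d]
    by (simp add: take_Suc_conv_app_nth graph_after_def)
qed

lemma valid_ops: "1 \<le> w \<Longrightarrow> valid_ops nedges w (ops d)"
  using operation_step by (simp add: valid_ops_def nth_ops graph_after_ops)

lemma present_final: "present False (nops False) = {..<nedges}"
proof -
  have "{i. 3 * i < 3 * N} = {..<N}" "{i. 3 * i + 2 < 3 * N} = {..<N}" by auto
  then show ?thesis
    using present_stage[of False "3 * N"] by (simp add: nops_def lessThan_nedges)
qed

text \<open>With as many nodes as arcs, the lower bound is an equality and the upper one only needs
  a logarithm of at least one.\<close>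

lemma nearly_linear: "1 \<le> c \<Longrightarrow> nearly_linear c nedges nedges"
proof -
  assume c: "1 \<le> c"
  have "1 \<le> log 2 (real nedges)" using nedges_ge(2) by simp
  then have "1 * 1 \<le> real c * log 2 (real nedges) ^ c"
    using c by (intro mult_mono one_le_power) auto
  then have "real nedges * 1 \<le> real nedges * (real c * log 2 (real nedges) ^ c)"
    by (intro mult_left_mono) auto
  then show ?thesis by (simp add: nearly_linear_def algebra_simps)
qed

lemma operation_query:
  assumes "x < nops d" "operation d x = Query"
  obtains i where "i < N" "x = ninit d + 3 * i + 1"
  using assms(1)
proof (cases rule: ops_cases)
  case init
  then show ?thesis using assms by (simp add: insert_op_def)
next
  case (stage i r)
  then have "r = 1" using assms operation_stage[OF stage(2), of d i]
    by (auto simp: insert_op_def delete_op_def split: if_splits)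
  then show ?thesis using that stage by blast
qed

text \<open>The second claim is for the running time: it keeps the answers short enough to be copied
  and compared in time linear in \<open>b\<close>.\<close>

lemma query_value:
  assumes "i < N" "x = ninit d + 3 * i + 1"
    and "is_max_flow_value nedges (graph_after (take x (ops d))) 0 1 (real r)"
  shows "r = full d x \<longleftrightarrow> (\<forall>l<N. blocked i l)" "r \<le> N * N"
proof -
  have x: "x \<le> nops d" using assms by (simp add: nops_def)
  have o: "others d i \<subseteq> {..<N}" "i \<notin> others d i"
    "card (others d i) = (if d then N - Suc i else i)" using others[OF assms(1)] by auto
  have v: "is_max_flow_value nedges (gr (stage (others d i) i)) 0 1 (real r)"
    using assms(3) graph_after_ops[OF x] present_query[OF assms(1), of d] assms(2) by simp
  have f: "full d x = N * (card (others d i) + 1)"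
  proof -
    have "(x - ninit d) div 3 = i" unfolding assms(2) by simp
    then have "full d x = N * (if d then N - i else i + 1)" by (simp add: full_def)
    also have "(if d then N - i else i + 1) = card (others d i) + 1" using o(3) assms(1) by auto
    finally show ?thesis .
  qed
  note m = max_flow_value_full_iff[OF o(1) assms(1) o(2) v]
  have "real (full d x) = real N * (real (card (others d i)) + 1)"
    unfolding f by (simp add: algebra_simps)
  then show "r = full d x \<longleftrightarrow> (\<forall>l<N. blocked i l)"
    using m(1) by (metis of_nat_eq_iff)
  have "real r \<le> real (full d x)" using m(2) f by (simp add: algebra_simps)
  moreover have "full d x \<le> N * N" unfolding f using o(3) assms(1) by (intro mult_le_mono2) auto
  ultimately show "r \<le> N * N" by simp
qed

lemma query_value_full_iff:
  assumes "\<And>x. x < nops d \<Longrightarrow> operation d x = Query \<Longrightarrow>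
    is_max_flow_value nedges (graph_after (take x (ops d))) 0 1 (real (outs ! x))"
  shows "(\<exists>x<nops d. operation d x = Query \<and> outs ! x \<noteq> full d x) \<longleftrightarrow>
    (\<exists>i<N. \<exists>l<N. \<not> blocked i l)"
proof
  assume "\<exists>x<nops d. operation d x = Query \<and> outs ! x \<noteq> full d x"
  then obtain x where x: "x < nops d" "operation d x = Query" "outs ! x \<noteq> full d x" by blast
  obtain i where i: "i < N" "x = ninit d + 3 * i + 1" using operation_query[OF x(1,2)] .
  show "\<exists>i<N. \<exists>l<N. \<not> blocked i l"
    using query_value(1)[OF i assms[OF x(1,2)]] x(3) i(1) by blast
next
  assume "\<exists>i<N. \<exists>l<N. \<not> blocked i l"
  then obtain i where i: "i < N" "\<not> (\<forall>l<N. blocked i l)" by blast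
  define x where "x = ninit d + 3 * i + 1"
  have x: "x < nops d" "operation d x = Query"
    using i operation_stage[of 1 d i] by (auto simp: x_def nops_def)
  show "\<exists>x<nops d. operation d x = Query \<and> outs ! x \<noteq> full d x"
    using query_value(1)[OF i(1) x_def assms[OF x]] i(2) x by blast
qed

end

definition solves :: "bool \<Rightarrow> nat \<Rightarrow> nat \<Rightarrow> real \<Rightarrow> prog \<Rightarrow> bool" where
  "solves d = (if d then solves_decremental_max_flow else solves_incremental_max_flow)"

text \<open>The constant \<open>A\<close> is obtained before \<open>N\<close>, \<open>k\<close> and
  \<open>sat\<close>, so it is uniform over all formulas. In the decremental case the sequence is
  cut after \<open>nedges\<close> insertions.\<close>

lemma solves_maintains:
  assumes "solves d c w \<epsilon> P" "1 \<le> c" "1 \<le> w"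
  shows "\<exists>A. \<forall>N k sat. 2 \<le> N \<longrightarrow> maintains_max_flow P (network.nedges N k) 0 1
    (network.ops N k sat d) (A * real (network.nedges N k) powr (1 - \<epsilon>) * real (network.nops N k d))"
proof (cases d)
  case False
  then have "solves_incremental_max_flow c w \<epsilon> P" using assms(1) by (simp add: solves_def)
  then obtain A where A: "\<forall>n s t ops. s < n \<and> t < n \<and> s \<noteq> t \<and> valid_ops n w ops \<and>
      (\<forall>q \<in> set ops. is_insert q \<or> q = Query) \<and>
      nearly_linear c n (card (edges (graph_after ops))) \<longrightarrow>
      maintains_max_flow P n s t ops
        (A * real (card (edges (graph_after ops))) powr (1 - \<epsilon>) * real (length ops))"
    unfolding solves_incremental_max_flow_def Let_def by (elim exE)
  have "maintains_max_flow P (network.nedges N k) 0 1 (network.ops N k sat False)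
      (A * real (network.nedges N k) powr (1 - \<epsilon>) * real (network.nops N k False))" if "2 \<le> N" for N k sat
  proof -
    interpret network N k sat by unfold_locales (rule that)
    have m: "card (edges (graph_after (ops False))) = nedges"
      using graph_after_ops[of "nops False" False] card_edges_gr[of "{..<nedges}"] present_final by simp
    have "\<forall>q \<in> set (ops False). is_insert q \<or> q = Query"
      by (auto simp: ops_def operation_def insert_op_def Let_def)
    then show ?thesis
      using A[rule_format, of 0 nedges 1 "ops False"] nedges_ge valid_ops[OF assms(3)] nearly_linear[OF assms(2)]
      unfolding m by simp
  qed
  then show ?thesis using False by (intro exI[of _ A]) simp
next
  case True
  then have "solves_decremental_max_flow c w \<epsilon> P" using assms(1) by (simp add: solves_def)
  then obtain A where A: "\<forall>n s t init ops. s < n \<and> t < n \<and> s \<noteq> t \<and> valid_ops n w (init @ ops) \<and>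
      (\<forall>q \<in> set init. is_insert q) \<and> (\<forall>q \<in> set ops. is_delete q \<or> q = Query) \<and>
      nearly_linear c n (card (edges (graph_after init))) \<longrightarrow>
      maintains_max_flow P n s t (init @ ops)
        (A * real (card (edges (graph_after init))) powr (1 - \<epsilon>) * real (length (init @ ops)))"
    unfolding solves_decremental_max_flow_def Let_def by (elim exE)
  have "maintains_max_flow P (network.nedges N k) 0 1 (network.ops N k sat True)
      (A * real (network.nedges N k) powr (1 - \<epsilon>) * real (network.nops N k True))" if "2 \<le> N" for N k sat
  proof -
    interpret network N k sat by unfold_locales (rule that)
    let ?i = "take nedges (ops True)" and ?o = "drop nedges (ops True)"
    have le: "nedges \<le> nops True" "ninit True = nedges" by (simp_all add: nops_def ninit_def)
    have m: "card (edges (graph_after ?i)) = nedges"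
      using graph_after_ops[OF le(1)] card_edges_gr[of "{..<nedges}"] present_ninit[of True] le by simp
    have "\<forall>q \<in> set ?i. is_insert q"
      using le by (auto simp: ops_def take_map operation_def insert_op_def)
    moreover have "\<forall>q \<in> set ?o. is_delete q \<or> q = Query"
      using le by (auto simp: ops_def drop_map operation_def delete_op_def Let_def)
    ultimately show ?thesis
      using A[rule_format, of 0 nedges 1 ?i ?o] nedges_ge valid_ops[OF assms(3), of True]
        nearly_linear[OF assms(2)] length_ops[of True]
      unfolding m by simp
  qed
  then show ?thesis using True by (intro exI[of _ A]) simp
qed

section \<open>Splitting assignments\<close>

text \<open>The quotient \<open>i div 2 ^ h\<close> tells which half \<open>i\<close> assigns, and
  the binary digits of \<open>i mod 2 ^ h\<close> are the truth values. Variable \<open>x\<close> is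
  digit \<open>x mod h\<close> of half \<open>x div h\<close>.\<close>

definition lit_sat :: "nat \<Rightarrow> nat \<Rightarrow> literal \<Rightarrow> bool" where
  "lit_sat h i L \<longleftrightarrow> fst L div h = i div 2 ^ h \<and> (i mod 2 ^ h div 2 ^ (fst L mod h)) mod 2 = of_bool (snd L)"

definition clause_sat :: "nat \<Rightarrow> cnf \<Rightarrow> nat \<Rightarrow> nat \<Rightarrow> bool" where
  "clause_sat h F i j \<longleftrightarrow> (\<exists>L\<in>set (F ! j). lit_sat h i L)"

lemma ex_binary_digits: "\<exists>i<2 ^ h. \<forall>x<h. i div 2 ^ x mod 2 = (of_bool (\<alpha> x) :: nat)"
proof (induction h arbitrary: \<alpha>)
  case (Suc h)
  obtain i where i: "i < 2 ^ h" "\<And>x. x < h \<Longrightarrow> i div 2 ^ x mod 2 = (of_bool (\<alpha> (Suc x)) :: nat)"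
    using Suc[of "\<lambda>x. \<alpha> (Suc x)"] by blast
  let ?i = "2 * i + of_bool (\<alpha> 0)"
  have "?i div 2 ^ x mod 2 = (of_bool (\<alpha> x) :: nat)" if "x < Suc h" for x
  proof (cases x)
    case (Suc y)
    have "?i div 2 ^ x = ?i div 2 div 2 ^ y" using Suc by (simp add: div_mult2_eq)
    also have "?i div 2 = i" by simp
    finally show ?thesis using i(2)[of y] Suc that by simp
  qed simp
  moreover have "?i < 2 ^ Suc h" using i(1) by (cases "\<alpha> 0") auto
  ultimately show ?case by blast
qed simp

text \<open>Every literal belongs to exactly one half because variables are below
  \<open>2 * h\<close>. Hence a clause holds under the combined assignment iff one of the halves
  satisfies it alone.\<close>

lemma satisfiable_split:
  assumes F: "k_cnf kk n F" and h: "1 \<le> h" "n \<le> 2 * h"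
  shows "satisfiable F \<longleftrightarrow>
    (\<exists>i<2 ^ h. \<exists>l<2 ^ h. \<forall>j<length F. clause_sat h F i j \<or> clause_sat h F (2 ^ h + l) j)"
proof
  assume "satisfiable F"
  then obtain \<alpha> where \<alpha>: "\<And>C. C \<in> set F \<Longrightarrow> \<exists>(x, b) \<in> set C. \<alpha> x = b"
    unfolding satisfiable_def by blast
  obtain i where i: "i < 2 ^ h" "\<And>x. x < h \<Longrightarrow> i div 2 ^ x mod 2 = (of_bool (\<alpha> x) :: nat)"
    using ex_binary_digits by metis
  obtain l where l: "l < 2 ^ h" "\<And>x. x < h \<Longrightarrow> l div 2 ^ x mod 2 = (of_bool (\<alpha> (h + x)) :: nat)"
    using ex_binary_digits[of h "\<lambda>x. \<alpha> (h + x)"] by blast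
  have "clause_sat h F i j \<or> clause_sat h F (2 ^ h + l) j" if j: "j < length F" for j
  proof -
    obtain x b where x: "(x, b) \<in> set (F ! j)" "\<alpha> x = b" using \<alpha>[of "F ! j"] j by auto
    have "x < n" using F x(1) j unfolding k_cnf_def by (metis (lifting) case_prodD nth_mem)
    then have x2: "x < 2 * h" using h by simp
    show ?thesis
    proof (cases "x < h")
      case True
      then have "lit_sat h i (x, b)" using i x(2) by (simp add: lit_sat_def)
      then show ?thesis using x(1) by (auto simp: clause_sat_def)
    next
      case False
      then have "x div h = 1" "x mod h = x - h"
        using x2 by (auto simp: div_nat_eqI le_mod_geq)
      then have "lit_sat h (2 ^ h + l) (x, b)"
        using l(1) l(2)[of "x - h"] x(2) x2 False by (simp add: lit_sat_def)
      then show ?thesis using x(1) by (auto simp: clause_sat_def)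
    qed
  qed
  then show "\<exists>i<2 ^ h. \<exists>l<2 ^ h. \<forall>j<length F. clause_sat h F i j \<or> clause_sat h F (2 ^ h + l) j"
    using i(1) l(1) by blast
next
  assume "\<exists>i<2 ^ h. \<exists>l<2 ^ h. \<forall>j<length F. clause_sat h F i j \<or> clause_sat h F (2 ^ h + l) j"
  then obtain i l where i: "i < 2 ^ h" and l: "l < 2 ^ h" and
    sat: "\<And>j. j < length F \<Longrightarrow> clause_sat h F i j \<or> clause_sat h F (2 ^ h + l) j" by blast
  define \<alpha> where "\<alpha> x \<longleftrightarrow> (if x < h then i else l) div 2 ^ (x mod h) mod 2 = 1" for x
  have "\<exists>(x, b) \<in> set C. \<alpha> x = b" if C: "C \<in> set F" for C
  proof -
    obtain j where j: "j < length F" "F ! j = C"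
      using C unfolding in_set_conv_nth by (elim exE conjE)
    show ?thesis
    proof (rule disjE[OF sat[OF j(1)]])
      assume "clause_sat h F i j"
      then obtain L where L: "L \<in> set C" "lit_sat h i L"
        unfolding clause_sat_def j(2) by (elim bexE)
      then have "fst L < h" using i h by (simp add: lit_sat_def div_eq_0_iff)
      then have "\<alpha> (fst L) = snd L" using L(2) i by (cases "snd L") (simp_all add: lit_sat_def \<alpha>_def)
      then show ?thesis using L(1) by (intro bexI[of _ L]) auto
    next
      assume "clause_sat h F (2 ^ h + l) j"
      then obtain L where L: "L \<in> set C" "lit_sat h (2 ^ h + l) L"
        unfolding clause_sat_def j(2) by (elim bexE)
      then have "fst L div h = 1" using l by (simp add: lit_sat_def)
      then have "\<not> fst L < h" by auto
      then have "\<alpha> (fst L) = snd L" using L(2) l by (cases "snd L") (simp_all add: lit_sat_def \<alpha>_def)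
      then show ?thesis using L(1) by (intro bexI[of _ L]) auto
    qed
  qed
  then show "satisfiable F" unfolding satisfiable_def by blast
qed

section \<open>The reduction as a program\<close>

text \<open>Choosing the constant as a function of the program alone makes it independent of the
  formula and of \<open>n\<close>, so the final time bound is uniform.\<close>

definition speed :: "prog \<Rightarrow> nat" where
  "speed P = (SOME K. \<forall>\<sigma> b. small b (read P) \<sigma> \<longrightarrow> runs P \<sigma> (K * b) (sem P \<sigma>))"

definition test_speed :: "expr \<Rightarrow> nat" where
  "test_speed e = (SOME K. \<forall>\<sigma> b. small b (arrays e) \<sigma> \<longrightarrow> cost e \<sigma> \<le> K * b \<and> bits (val e \<sigma>) \<le> K * b)"

lemma speed:
  assumes "loop_free P" "small b R \<sigma>" "read P \<subseteq> R"
  shows "runs P \<sigma> (speed P * b) (sem P \<sigma>)"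
proof -
  have "\<forall>\<sigma> b. small b (read P) \<sigma> \<longrightarrow> runs P \<sigma> (speed P * b) (sem P \<sigma>)"
    unfolding speed_def by (rule someI_ex[OF loop_free_runs[OF assms(1)]])
  then show ?thesis using small_mono[OF assms(2) le_refl assms(3)] by blast
qed

lemma test_speed:
  assumes "small b R \<sigma>" "arrays e \<subseteq> R"
  shows "cost e \<sigma> \<le> test_speed e * b" "bits (val e \<sigma>) \<le> test_speed e * b"
proof -
  have "\<exists>K. \<forall>\<sigma> b. small b (arrays e) \<sigma> \<longrightarrow> cost e \<sigma> \<le> K * b \<and> bits (val e \<sigma>) \<le> K * b"
    using expr_cost_bound by blast
  then have "\<forall>\<sigma> b. small b (arrays e) \<sigma> \<longrightarrow> cost e \<sigma> \<le> test_speed e * b \<and> bits (val e \<sigma>) \<le> test_speed e * b"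
    unfolding test_speed_def by (rule someI_ex)
  then show "cost e \<sigma> \<le> test_speed e * b" "bits (val e \<sigma>) \<le> test_speed e * b"
    using small_mono[OF assms(1) le_refl assms(2)] by blast+
qed

definition loop_speed :: "expr \<Rightarrow> prog \<Rightarrow> nat" where
  "loop_speed e P = speed P + 2 * test_speed e + 1"

lemma runs_loop:
  assumes "loop_free P" "read P \<subseteq> R" "arrays e \<subseteq> R"
    and small: "\<And>q. q \<le> c \<Longrightarrow> small b R (S q)"
    and test: "\<And>q. q \<le> c \<Longrightarrow> val e (S q) = of_bool (q < c)"
    and step: "\<And>q. q < c \<Longrightarrow> sem P (S q) = S (Suc q)"
  shows "runs (While e P) (S 0) (Suc c * (loop_speed e P * b)) (S c)"
proof -
  have b: "1 \<le> b" using small[of c] by (simp add: small_def)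
  have "runs (While e P) (S 0) (Suc c * (speed P * b + 2 * (test_speed e * b) + 1)) (S c)"
  proof (rule runs_While)
    fix q assume q: "q < c"
    show "val e (S q) \<noteq> 0" using test[of q] q by simp
    show "runs P (S q) (speed P * b) (S (Suc q))"
      using speed[OF assms(1) small assms(2), of q] q step[OF q] by simp
  next
    fix q assume "q \<le> c"
    then show "cost e (S q) \<le> test_speed e * b \<and> bits (val e (S q)) \<le> test_speed e * b"
      using test_speed[OF small assms(3)] by blast
  qed (use test[of c] in simp)
  moreover have "speed P * b + 2 * (test_speed e * b) + 1 \<le> loop_speed e P * b"
    using b by (simp add: loop_speed_def algebra_simps)
  ultimately show ?thesis by (rule runs_mono[OF _ mult_le_mono2])
qed

definition mod_expr :: "expr \<Rightarrow> expr \<Rightarrow> expr" where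
  "mod_expr e1 e2 = Bin Minus e1 (Bin Times (Bin Div e1 e2) e2)"

text \<open>Subtraction is truncated: the sum of both differences vanishes only for equal values,
  and subtracting from one negates a truth value.\<close>

definition eq_expr :: "expr \<Rightarrow> expr \<Rightarrow> expr" where
  "eq_expr e1 e2 = Bin Minus (Num 1) (Bin Plus (Bin Minus e1 e2) (Bin Minus e2 e1))"

definition less_expr :: "expr \<Rightarrow> expr \<Rightarrow> expr" where
  "less_expr e1 e2 = Bin Minus (Num 1) (Bin Minus (Num 1) (Bin Minus e2 e1))"

lemma val_test_exprs [simp]:
  "val (mod_expr e1 e2) \<sigma> = val e1 \<sigma> mod val e2 \<sigma>"
  "val (eq_expr e1 e2) \<sigma> = of_bool (val e1 \<sigma> = val e2 \<sigma>)"
  "val (less_expr e1 e2) \<sigma> = of_bool (val e1 \<sigma> < val e2 \<sigma>)"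
  by (auto simp: mod_expr_def eq_expr_def less_expr_def minus_div_mult_eq_mod of_bool_def)

lemma arrays_test_exprs [simp]:
  "arrays (mod_expr e1 e2) = arrays e1 \<union> arrays e2"
  "arrays (eq_expr e1 e2) = arrays e1 \<union> arrays e2"
  "arrays (less_expr e1 e2) = arrays e1 \<union> arrays e2"
  by (auto simp: mod_expr_def eq_expr_def less_expr_def)

lemma val_upper:
  "arrays e \<subseteq> {B..} \<Longrightarrow> val e (join B \<tau> z) = val e (join B \<tau>' z)"
  by (induction e) (auto simp: join_def)

text \<open>
  The memory of the reduction: the input formula in array 3, the positions of its clauses in array 4,
  the powers of two in array 5, and scalars in the arrays 6 to 11. (The simplifier would turn
  \<open>B + 1\<close> and \<open>B + 2\<close> into successors.)
\<close>

definition memory ::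
    "(nat \<Rightarrow> nat) \<Rightarrow> (nat \<Rightarrow> nat) \<Rightarrow> (nat \<Rightarrow> nat) \<Rightarrow> nat \<Rightarrow> nat \<Rightarrow> nat \<Rightarrow> nat \<Rightarrow> nat \<Rightarrow> nat \<Rightarrow> mem" where
  "memory Z st pw x fl k h N r = (\<lambda>a i.
     if a = 3 then Z i else if a = 4 then st i else if a = 5 then pw i
     else if i \<noteq> 0 then 0
     else if a = 6 then x else if a = 7 then fl else if a = 8 then k else if a = 9 then h
     else if a = 10 then N else if a = 11 then r else 0)"

lemma memory_read [simp]:
  "memory Z st pw x fl k h N r 3 = Z"
  "memory Z st pw x fl k h N r 4 = st"
  "memory Z st pw x fl k h N r 5 = pw"
  "memory Z st pw x fl k h N r 6 0 = x"
  "memory Z st pw x fl k h N r 7 0 = fl"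
  "memory Z st pw x fl k h N r 8 0 = k"
  "memory Z st pw x fl k h N r 9 0 = h"
  "memory Z st pw x fl k h N r 10 0 = N"
  "memory Z st pw x fl k h N r 11 0 = r"
  by (auto simp: memory_def)

text \<open>Scalar arrays vanish off index \<open>0\<close>, so the array being updated may come
  from any other \<open>memory\<close>; this covers chains of assignments.\<close>

lemma memory_update [simp]:
  "(memory Z st pw x fl k h N r)(3 := Z') = memory Z' st pw x fl k h N r"
  "(memory Z st pw x fl k h N r)(4 := st') = memory Z st' pw x fl k h N r"
  "(memory Z st pw x fl k h N r)(5 := pw') = memory Z st pw' x fl k h N r"
  "(memory Z st pw x fl k h N r)(6 := (memory Z' st' pw' x' fl' k' h' N' r' 6)(0 := y)) = memory Z st pw y fl k h N r"
  "(memory Z st pw x fl k h N r)(7 := (memory Z' st' pw' x' fl' k' h' N' r' 7)(0 := y)) = memory Z st pw x y k h N r"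
  "(memory Z st pw x fl k h N r)(8 := (memory Z' st' pw' x' fl' k' h' N' r' 8)(0 := y)) = memory Z st pw x fl y h N r"
  "(memory Z st pw x fl k h N r)(9 := (memory Z' st' pw' x' fl' k' h' N' r' 9)(0 := y)) = memory Z st pw x fl k y N r"
  "(memory Z st pw x fl k h N r)(10 := (memory Z' st' pw' x' fl' k' h' N' r' 10)(0 := y)) = memory Z st pw x fl k h y r"
  "(memory Z st pw x fl k h N r)(11 := (memory Z' st' pw' x' fl' k' h' N' r' 11)(0 := y)) = memory Z st pw x fl k h N y"
  by (auto simp: memory_def fun_eq_iff)

text \<open>Of the subroutine's memory at most array \<open>0\<close> may occur in \<open>R\<close>;
  its other arrays are not bounded.\<close>

lemma small_memory:
  assumes "1 \<le> b" "\<And>i. Z i < 2 ^ b" "\<And>i. st i < 2 ^ b" "\<And>i. pw i < 2 ^ b"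
    "x < 2 ^ b" "fl < 2 ^ b" "k < 2 ^ b" "h < 2 ^ b" "N < 2 ^ b" "r < 2 ^ b"
    and "\<And>i. 0 \<in> R \<Longrightarrow> \<tau> 0 i < 2 ^ b" "R \<subseteq> insert 0 {B..}" "0 < B"
  shows "small b R (join B \<tau> (memory Z st pw x fl k h N r))"
  using assms by (auto simp: small_def bits_le_iff join_def memory_def)

definition send :: "expr \<Rightarrow> expr \<Rightarrow> expr \<Rightarrow> expr \<Rightarrow> prog" where
  "send e0 e1 e2 e3 = Seq (Assign 0 (Num 0) e0) (Seq (Assign 0 (Num 1) e1)
     (Seq (Assign 0 (Num 2) e2) (Assign 0 (Num 3) e3)))"

lemma send_shape [simp]:
  "loop_free (send e0 e1 e2 e3)"
  "read (send e0 e1 e2 e3) = arrays e0 \<union> arrays e1 \<union> arrays e2 \<union> arrays e3"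
  by (auto simp: send_def)

lemma store4: "store [a, b, c, d] \<tau> = \<tau>(0 := (\<tau> 0)(0 := a, 1 := b, 2 := c, 3 := d))"
proof -
  have "i < 4 \<longleftrightarrow> i = 0 \<or> i = 1 \<or> i = 2 \<or> i = (3::nat)" for i by auto
  then show ?thesis by (auto simp: store_def fun_eq_iff)
qed

text \<open>The expressions read only arrays from \<open>B\<close> on, so the cells of array
  \<open>0\<close> that are already overwritten cannot disturb the later ones.\<close>

lemma sem_send:
  assumes "0 < B" "arrays e0 \<union> arrays e1 \<union> arrays e2 \<union> arrays e3 \<subseteq> {B..}"
  shows "sem (send e0 e1 e2 e3) (join B \<tau> z) =
    join B (store [val e0 (join B \<tau> z), val e1 (join B \<tau> z), val e2 (join B \<tau> z), val e3 (join B \<tau> z)] \<tau>) z"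
proof -
  have "\<exists>v. \<forall>\<tau>. val e (join B \<tau> z) = v" if "arrays e \<subseteq> {B..}" for e
    using val_upper[OF that] by blast
  then obtain v0 v1 v2 v3 where "\<And>\<tau>. val e0 (join B \<tau> z) = v0" "\<And>\<tau>. val e1 (join B \<tau> z) = v1"
      "\<And>\<tau>. val e2 (join B \<tau> z) = v2" "\<And>\<tau>. val e3 (join B \<tau> z) = v3"
    using assms(2) by (metis Un_subset_iff)
  then show ?thesis using assms(1) unfolding store4
    by (simp add: send_def) (simp add: fun_upd_def)
qed

section \<open>The program text, with its own arrays shifted by \<open>B\<close>\<close>

context
  fixes B :: nat
begin

abbreviation (input) "cell a \<equiv> Cell (B + a) (Num 0)"
abbreviation (input) "add \<equiv> Bin Plus"
abbreviation (input) "sub \<equiv> Bin Minus"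
abbreviation (input) "mul \<equiv> Bin Times"

definition assignment_expr :: expr where "assignment_expr = Bin Div (cell 6) (cell 8)"

definition clause_index_expr :: expr where "clause_index_expr = mod_expr (cell 6) (cell 8)"

text \<open>\<open>lit_sat\<close> for the encoded literal at cell \<open>q\<close>. The machine has
  no exponentiation, so the power of two comes from the table in array \<open>B + 5\<close>.\<close>

definition literal_expr :: "expr \<Rightarrow> expr" where
  "literal_expr q = (let v = Bin Div (Cell (B + 3) q) (Num 2) in
     mul (eq_expr (Bin Div v (cell 9)) (Bin Div assignment_expr (cell 10)))
       (eq_expr (mod_expr (Bin Div (mod_expr assignment_expr (cell 10)) (Cell (B + 5) (mod_expr v (cell 9)))) (Num 2))
         (mod_expr (Cell (B + 3) q) (Num 2))))"

definition start_expr :: expr where "start_expr = Cell (B + 4) clause_index_expr"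

text \<open>A disjunction as a sum, unrolled over at most \<open>kk\<close> literals to avoid a
  loop. The guard stops at the clause's own length, beyond which the cells do not belong to
  it.\<close>

fun clause_expr :: "nat \<Rightarrow> expr" where
  "clause_expr 0 = Num 0"
| "clause_expr (Suc l) = add (clause_expr l)
     (mul (less_expr (Num l) (Cell (B + 3) start_expr)) (literal_expr (add start_expr (Num (Suc l)))))"

definition nclause_expr :: expr where "nclause_expr = mul (mul (Num 2) (cell 10)) (cell 8)"

definition nbase_expr :: expr where "nbase_expr = add nclause_expr (cell 10)"

definition nedges_expr :: expr where
  "nedges_expr = mul (cell 10) (add (mul (Num 2) (cell 8)) (Num 3))"

definition ninit_expr :: "bool \<Rightarrow> expr" where
  "ninit_expr d = (if d then nedges_expr else nbase_expr)"

definition nops_expr :: "bool \<Rightarrow> expr" where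
  "nops_expr d = add (ninit_expr d) (mul (Num 3) (cell 10))"

definition stage_expr :: "bool \<Rightarrow> expr" where
  "stage_expr d = Bin Div (sub (cell 6) (ninit_expr d)) (Num 3)"

definition step_expr :: "bool \<Rightarrow> expr" where
  "step_expr d = mod_expr (sub (cell 6) (ninit_expr d)) (Num 3)"

definition node_expr :: "expr \<Rightarrow> expr" where "node_expr e = add (Num 2) e"

definition clause_node_expr :: expr where
  "clause_node_expr = add (node_expr (mul (Num 2) (cell 10))) clause_index_expr"

definition send_clause :: "nat \<Rightarrow> prog" where
  "send_clause kk =
     Branch (clause_expr kk)
       (send (Num 1) (node_expr assignment_expr) (add clause_node_expr (cell 8)) (cell 10))
     (Branch (less_expr assignment_expr (cell 10))
       (send (Num 1) (node_expr assignment_expr) clause_node_expr (cell 10))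
       (send (Num 1) clause_node_expr (node_expr assignment_expr) (cell 10)))"

definition send_right :: prog where
  "send_right = send (Num 1) (add (node_expr (cell 10)) (sub (cell 6) nclause_expr)) (Num 1) (Num 1)"

definition send_source :: "expr \<Rightarrow> prog" where
  "send_source e = send (Num 1) (Num 0) (node_expr e) (cell 10)"

definition send_sink :: "expr \<Rightarrow> prog" where
  "send_sink e = send (Num 1) (node_expr e) (Num 1) (cell 10)"

definition send_stage :: "bool \<Rightarrow> prog" where
  "send_stage d = Branch (eq_expr (step_expr d) (Num 1)) (send (Num 3) (Num 0) (Num 0) (Num 0))
    (Branch (eq_expr (step_expr d) (Num 0))
      (if d then send (Num 2) (node_expr (stage_expr d)) (Num 1) (Num 0) else send_source (stage_expr d))
      (if d then send (Num 2) (Num 0) (node_expr (stage_expr d)) (Num 0) else send_sink (stage_expr d)))"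

definition send_operation :: "bool \<Rightarrow> nat \<Rightarrow> prog" where
  "send_operation d kk = Branch (less_expr (cell 6) nclause_expr) (send_clause kk)
    (Branch (less_expr (cell 6) nbase_expr) send_right
      (if d then
        Branch (less_expr (cell 6) (add nbase_expr (cell 10))) (send_source (sub (cell 6) nbase_expr))
        (Branch (less_expr (cell 6) nedges_expr) (send_sink (sub (cell 6) (add nbase_expr (cell 10))))
          (send_stage d))
      else send_stage d))"

definition query_expr :: "bool \<Rightarrow> expr" where
  "query_expr d = mul (sub (Num 1) (less_expr (cell 6) (ninit_expr d))) (eq_expr (step_expr d) (Num 1))"

definition full_expr :: "bool \<Rightarrow> expr" where
  "full_expr d = mul (cell 10)
     (if d then sub (cell 10) (stage_expr d) else add (stage_expr d) (Num 1))"

text \<open>Kept apart from \<open>check\<close> because it reads array \<open>1\<close>, which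
  belongs to the subroutine and has a bounded entry only after a query.\<close>

definition fetch :: prog where "fetch = Assign (B + 11) (Num 0) (Cell 1 (Num 0))"

definition check :: "bool \<Rightarrow> prog" where
  "check d = Seq (Branch (query_expr d)
      (Branch (eq_expr (cell 11) (full_expr d)) Skip (Assign (B + 7) (Num 0) (Num 1))) Skip)
    (Seq (Assign (B + 11) (Num 0) (Num 0)) (Assign (B + 6) (Num 0) (add (cell 6) (Num 1))))"

definition serve_loop :: "bool \<Rightarrow> nat \<Rightarrow> prog \<Rightarrow> prog" where
  "serve_loop d kk P = While (less_expr (cell 6) (nops_expr d))
     (Seq (send_operation d kk) (Seq P (Seq (Branch (query_expr d) fetch Skip) (check d))))"

text \<open>Adding one to half of the number of variables covers odd \<open>n\<close> and makes
  \<open>h\<close> positive, hence \<open>N\<close> at least \<open>2\<close>.\<close>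

definition parameters :: prog where
  "parameters = Seq (Assign (B + 8) (Num 0) (Cell 0 (Num 1)))
     (Assign (B + 9) (Num 0) (add (Bin Div (Cell 0 (Num 0)) (Num 2)) (Num 1)))"

text \<open>The input length is not given, but each clause takes at most \<open>Suc kk\<close> cells
  after the two header cells; the cells beyond the input are zero.\<close>

definition move_test :: "nat \<Rightarrow> expr" where
  "move_test kk = less_expr (cell 6) (add (Num 2) (mul (cell 8) (Num (Suc kk))))"

text \<open>Each cell is erased after being copied, so that the subroutine later starts from blank
  memory.\<close>

definition move_input :: prog where
  "move_input = Seq (Assign (B + 3) (cell 6) (Cell 0 (cell 6)))
     (Seq (Assign 0 (cell 6) (Num 0)) (Assign (B + 6) (Num 0) (add (cell 6) (Num 1))))"

definition begin_positions :: prog where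
  "begin_positions = Seq (Assign (B + 6) (Num 0) (Num 0)) (Assign (B + 4) (Num 0) (Num 2))"

definition positions_test :: expr where "positions_test = less_expr (cell 6) (cell 8)"

definition positions :: prog where
  "positions = Seq (Assign (B + 4) (add (cell 6) (Num 1))
       (add (add (Cell (B + 4) (cell 6)) (Num 1)) (Cell (B + 3) (Cell (B + 4) (cell 6)))))
     (Assign (B + 6) (Num 0) (add (cell 6) (Num 1)))"

definition begin_powers :: prog where
  "begin_powers = Seq (Assign (B + 6) (Num 0) (Num 0)) (Assign (B + 5) (Num 0) (Num 1))"

definition powers_test :: expr where "powers_test = less_expr (cell 6) (cell 9)"

definition powers :: prog where
  "powers = Seq (Assign (B + 5) (add (cell 6) (Num 1))
       (add (Cell (B + 5) (cell 6)) (Cell (B + 5) (cell 6))))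
     (Assign (B + 6) (Num 0) (add (cell 6) (Num 1)))"

definition send_start :: prog where
  "send_start = Seq (Assign (B + 10) (Num 0) (Cell (B + 5) (cell 9)))
     (Seq (Assign (B + 6) (Num 0) (Num 0)) (send (Num 0) nedges_expr (Num 0) (Num 1)))"

definition preprocess :: "nat \<Rightarrow> prog" where
  "preprocess kk = Seq parameters (Seq (While (move_test kk) move_input)
     (Seq begin_positions (Seq (While positions_test positions)
     (Seq begin_powers (Seq (While powers_test powers) send_start)))))"

definition reduction :: "bool \<Rightarrow> nat \<Rightarrow> prog \<Rightarrow> prog" where
  "reduction d kk P = Seq (preprocess kk) (Seq P (Seq (serve_loop d kk P) (Assign 1 (Num 0) (cell 7))))"

lemmas expr_defs = assignment_expr_def clause_index_expr_def start_expr_def nclause_expr_def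
  nbase_expr_def nedges_expr_def ninit_expr_def nops_expr_def stage_expr_def step_expr_def
  node_expr_def clause_node_expr_def query_expr_def full_expr_def

lemma arrays_clause_expr: "arrays (clause_expr l) \<subseteq> {B..}"
  by (induction l) (auto simp: literal_expr_def expr_defs Let_def)

lemma arrays_upper:
  "arrays (node_expr e) = arrays e"
  "arrays assignment_expr \<subseteq> {B..}" "arrays clause_node_expr \<subseteq> {B..}" "arrays nclause_expr \<subseteq> {B..}"
  "arrays nbase_expr \<subseteq> {B..}" "arrays nedges_expr \<subseteq> {B..}"
  "arrays (nops_expr d) \<subseteq> {B..}" "arrays (stage_expr d) \<subseteq> {B..}" "arrays (step_expr d) \<subseteq> {B..}"
  "arrays (query_expr d) \<subseteq> {B..}" "arrays (full_expr d) \<subseteq> {B..}"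
  by (auto simp: expr_defs)

lemma send_operation_shape:
  "loop_free (send_operation d kk)" "read (send_operation d kk) \<subseteq> {B..}"
  using arrays_clause_expr[of kk] arrays_upper
  by (auto simp: send_operation_def send_clause_def send_right_def send_source_def send_sink_def
      send_stage_def subset_iff)

lemma check_shape: "loop_free (check d)" "read (check d) \<subseteq> {B..}"
  using arrays_upper by (auto simp: check_def subset_iff)

end

section \<open>The code emits exactly the operations of the network\<close>

lemma val_literal_expr:
  assumes "Z (val q (join B \<tau> (memory Z st pw x fl k h N r))) = enc_literal L"
    and "N = 2 ^ h" "\<And>y. y < h \<Longrightarrow> pw y = 2 ^ y" "0 < h"
  shows "val (literal_expr B q) (join B \<tau> (memory Z st pw x fl k h N r)) = of_bool (lit_sat h (x div k) L)"
proof -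
  obtain X b where L: "L = (X, b)" by (cases L)
  have "enc_literal L div 2 = X" "enc_literal L mod 2 = of_bool b" using L by (cases b; simp)+
  moreover have "pw (X mod h) = 2 ^ (X mod h)" using assms by simp
  ultimately show ?thesis
    using assms L by (simp add: literal_expr_def assignment_expr_def Let_def lit_sat_def)
qed

lemma val_clause_expr:
  assumes "Z (st (x mod k)) = length C"
    and "\<And>l. l < length C \<Longrightarrow> Z (st (x mod k) + Suc l) = enc_literal (C ! l)"
    and "N = 2 ^ h" "\<And>y. y < h \<Longrightarrow> pw y = 2 ^ y" "0 < h"
  shows "val (clause_expr B kk) (join B \<tau> (memory Z st pw x fl k h N r)) \<noteq> 0 \<longleftrightarrow>
    (\<exists>l<kk. l < length C \<and> lit_sat h (x div k) (C ! l))"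
proof (induction kk)
  case (Suc l)
  let ?\<sigma> = "join B \<tau> (memory Z st pw x fl k h N r)"
  have s: "val (start_expr B) ?\<sigma> = st (x mod k)" by (simp add: start_expr_def clause_index_expr_def)
  have "val (literal_expr B (Bin Plus (start_expr B) (Num (Suc l)))) ?\<sigma> = of_bool (lit_sat h (x div k) (C ! l))"
    if "l < length C"
    using assms that s by (intro val_literal_expr) auto
  then have "val (clause_expr B (Suc l)) ?\<sigma> \<noteq> 0 \<longleftrightarrow>
      val (clause_expr B l) ?\<sigma> \<noteq> 0 \<or> l < length C \<and> lit_sat h (x div k) (C ! l)"
    using s assms(1) by (auto simp: of_bool_def split: if_splits)
  then show ?case using Suc by (auto simp: less_Suc_eq)
qed simp

text \<open>With \<open>2 \<le> B\<close>, arrays \<open>0\<close> and \<open>1\<close>, through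
  which messages and answers pass, lie in the part of memory that \<open>P\<close> may use.\<close>

locale driver =
  fixes P :: prog and B kk n :: nat and F :: cnf and d :: bool
  assumes accessed: "accessed P \<subseteq> {..<B}" and B: "2 \<le> B" and F: "k_cnf kk n F"
begin

definition h :: nat where "h = n div 2 + 1"
definition N :: nat where "N = 2 ^ h"
definition k :: nat where "k = length F"

lemma N_ge_2: "2 \<le> N"
  by (simp add: N_def h_def)

sublocale network N k "clause_sat h F"
  by unfold_locales (rule N_ge_2)

definition code :: "literal list \<Rightarrow> nat list" where
  "code C = length C # map enc_literal C"

definition input :: "nat \<Rightarrow> nat" where
  "input i = (if i < length (enc_cnf n F) then enc_cnf n F ! i else 0)"

definition position :: "nat \<Rightarrow> nat" where
  "position j = 2 + length (concat (map code (take j F)))"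

text \<open>The table after \<open>q\<close> rounds of the loop that fills it;
  \<open>partial_powers\<close> is the analogue for the other table.\<close>

definition partial_positions :: "nat \<Rightarrow> nat \<Rightarrow> nat" where
  "partial_positions q i = (if i \<le> q then position i else 0)"

definition partial_powers :: "nat \<Rightarrow> nat \<Rightarrow> nat" where
  "partial_powers q i = (if i \<le> q then 2 ^ i else 0)"

definition state :: "nat \<Rightarrow> nat \<Rightarrow> nat \<Rightarrow> mem" where
  "state x fl r = memory input (partial_positions k) (partial_powers h) x fl k h N r"

lemma enc_cnf_code: "enc_cnf n F = n # k # concat (map code F)"
  by (simp add: enc_cnf_def k_def code_def[abs_def])

lemma position_0: "position 0 = 2"
  by (simp add: position_def)

lemma position_Suc: "j < k \<Longrightarrow> position (Suc j) = position j + 1 + length (F ! j)"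
  by (simp add: position_def k_def take_Suc_conv_app_nth code_def)

lemma input_clause:
  assumes "j < k" "i \<le> length (F ! j)"
  shows "input (position j + i) = code (F ! j) ! i"
proof -
  have F: "F = take j F @ F ! j # drop (Suc j) F" using assms(1) by (simp add: k_def id_take_nth_drop)
  have "concat (map code F) = concat (map code (take j F)) @ code (F ! j) @ concat (map code (drop (Suc j) F))"
    by (subst F) simp
  moreover have "i < length (code (F ! j))" using assms(2) by (simp add: code_def)
  ultimately show ?thesis by (simp add: input_def enc_cnf_code position_def nth_append)
qed

lemma clause_length: "j < k \<Longrightarrow> length (F ! j) \<le> kk"
  using F by (auto simp: k_cnf_def k_def)

lemma position_le: "j \<le> k \<Longrightarrow> position j \<le> 2 + k * Suc kk"
proof -
  assume "j \<le> k"
  have "j \<le> k \<Longrightarrow> position j \<le> 2 + j * Suc kk"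
  proof (induction j)
    case (Suc j)
    then show ?case using position_Suc[of j] clause_length[of j] by simp
  qed (simp add: position_0)
  also have "2 + j * Suc kk \<le> 2 + k * Suc kk" using \<open>j \<le> k\<close> by (intro add_left_mono mult_le_mono1)
  finally show ?thesis using \<open>j \<le> k\<close> by blast
qed

lemma length_enc_cnf: "length (enc_cnf n F) = position k"
  by (simp add: enc_cnf_code position_def k_def)

lemma input_0: "input 0 = n" and input_1: "input 1 = k"
  by (simp_all add: input_def enc_cnf_code)

lemma input_le: "input i \<le> 2 * n + kk + k"
proof (cases "i < length (enc_cnf n F)")
  case True
  then have "input i \<in> set (enc_cnf n F)" by (simp add: input_def)
  then consider "input i = n" | "input i = k" | C where "C \<in> set F" "input i \<in> set (code C)"
    by (auto simp: enc_cnf_code)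
  then show ?thesis
  proof cases
    case 3
    then consider "input i = length C" | L where "L \<in> set C" "input i = enc_literal L"
      by (auto simp: code_def)
    then show ?thesis
    proof cases
      case 1
      then show ?thesis using F 3 by (auto simp: k_cnf_def)
    next
      case 2
      obtain x v where L: "L = (x, v)" by (cases L)
      then have "x < n" using F 3 2 by (fastforce simp: k_cnf_def)
      then show ?thesis using 2 L by auto
    qed
  qed auto
qed (simp add: input_def)

lemma h_bounds: "0 < h" "n \<le> 2 * h" "h \<le> n + 1"
  by (auto simp: h_def)

lemma val_clause_sat:
  assumes "x < 2 * N * k"
  shows "val (clause_expr B kk) (join B \<tau> (state x fl r)) \<noteq> 0 \<longleftrightarrow> clause_sat h F (x div k) (x mod k)"
proof -
  let ?j = "x mod k" and ?C = "F ! (x mod k)"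
  have j: "?j < k" using div_mod_bounds[OF assms] by blast
  have st: "partial_positions k ?j = position ?j" using j by (simp add: partial_positions_def)
  have "val (clause_expr B kk) (join B \<tau> (state x fl r)) \<noteq> 0 \<longleftrightarrow>
      (\<exists>l<kk. l < length ?C \<and> lit_sat h (x div k) (?C ! l))"
    unfolding state_def
  proof (rule val_clause_expr)
    show "input (partial_positions k ?j) = length ?C"
      using input_clause[OF j, of 0] st by (simp add: code_def)
    show "input (partial_positions k ?j + Suc l) = enc_literal (?C ! l)" if "l < length ?C" for l
      using input_clause[OF j, of "Suc l"] st that by (simp add: code_def)
  qed (use h_bounds in \<open>auto simp: N_def partial_powers_def\<close>)
  also have "\<dots> \<longleftrightarrow> (\<exists>l<length ?C. lit_sat h (x div k) (?C ! l))"
    using clause_length[OF j] by (meson order_less_le_trans)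
  also have "\<dots> \<longleftrightarrow> clause_sat h F (x div k) ?j"
    by (metis clause_sat_def in_set_conv_nth)
  finally show ?thesis .
qed

lemma val_exprs [simp]:
  "val (assignment_expr B) (join B \<tau> (state x fl r)) = x div k"
  "val (clause_index_expr B) (join B \<tau> (state x fl r)) = x mod k"
  "val (clause_node_expr B) (join B \<tau> (state x fl r)) = 2 + 2 * N + x mod k"
  "val (nclause_expr B) (join B \<tau> (state x fl r)) = 2 * N * k"
  "val (nbase_expr B) (join B \<tau> (state x fl r)) = nbase"
  "val (nedges_expr B) (join B \<tau> (state x fl r)) = nedges"
  "val (ninit_expr B d') (join B \<tau> (state x fl r)) = ninit d'"
  "val (nops_expr B d') (join B \<tau> (state x fl r)) = nops d'"
  "val (stage_expr B d') (join B \<tau> (state x fl r)) = (x - ninit d') div 3"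
  "val (step_expr B d') (join B \<tau> (state x fl r)) = (x - ninit d') mod 3"
  "val (full_expr B d') (join B \<tau> (state x fl r)) = full d' x"
  "state x fl r 6 0 = x" "state x fl r 7 0 = fl" "state x fl r 8 0 = k" "state x fl r 10 0 = N"
  "state x fl r 11 0 = r"
  "val (node_expr e) \<sigma> = 2 + val e \<sigma>"
  by (auto simp: state_def expr_defs nbase_def nedges_def ninit_def nops_def full_def Let_def)

lemma val_query_expr [simp]:
  assumes "x < nops d"
  shows "val (query_expr B d) (join B \<tau> (state x fl r)) = of_bool (operation d x = Query)"
proof -
  have "operation d x = Query \<longleftrightarrow> \<not> x < ninit d \<and> (x - ninit d) mod 3 = 1"
    by (auto simp: operation_def insert_op_def delete_op_def Let_def)
  then show ?thesis by (simp add: query_expr_def)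
qed

lemma sem_send_clause:
  assumes "x < 2 * N * k"
  shows "sem (send_clause B kk) (join B \<tau> (state x fl r)) =
    join B (store (op_msg (insert_op x)) \<tau>) (state x fl r)"
proof -
  have "0 < B" using B by simp
  note send = sem_send[OF this]
  have s: "val (clause_expr B kk) (join B \<tau> (state x fl r)) = 0 \<longleftrightarrow> \<not> clause_sat h F (x div k) (x mod k)"
    using val_clause_sat[OF assms] by blast
  show ?thesis
    using assms s arrays_upper unfolding send_clause_def
    by (auto simp: send insert_op_def ends_def cap_def add.commute add.left_commute)
qed

lemma sem_send_edges:
  shows "2 * N * k \<le> x \<Longrightarrow> x < nbase \<Longrightarrow> sem (send_right B) (join B \<tau> (state x fl r)) =
      join B (store (op_msg (insert_op x)) \<tau>) (state x fl r)"
    and "arrays e \<subseteq> {B..} \<Longrightarrow> val e (join B \<tau> (state x fl r)) = i \<Longrightarrow> i < N \<Longrightarrow>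
      sem (send_source B e) (join B \<tau> (state x fl r)) =
      join B (store (op_msg (insert_op (nbase + i))) \<tau>) (state x fl r)"
    and "arrays e \<subseteq> {B..} \<Longrightarrow> val e (join B \<tau> (state x fl r)) = i \<Longrightarrow> i < N \<Longrightarrow>
      sem (send_sink B e) (join B \<tau> (state x fl r)) =
      join B (store (op_msg (insert_op (nbase + N + i))) \<tau>) (state x fl r)"
proof -
  have "0 < B" using B by simp
  note send = sem_send[OF this]
  show "2 * N * k \<le> x \<Longrightarrow> x < nbase \<Longrightarrow> sem (send_right B) (join B \<tau> (state x fl r)) =
      join B (store (op_msg (insert_op x)) \<tau>) (state x fl r)"
    using arrays_upper unfolding send_right_def
    by (auto simp: send insert_op_def ends_def cap_def)
  show "arrays e \<subseteq> {B..} \<Longrightarrow> val e (join B \<tau> (state x fl r)) = i \<Longrightarrow> i < N \<Longrightarrow>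
      sem (send_source B e) (join B \<tau> (state x fl r)) =
      join B (store (op_msg (insert_op (nbase + i))) \<tau>) (state x fl r)"
    using arrays_upper unfolding send_source_def
    by (auto simp: send insert_op_def ends_def cap_def nbase_def)
  show "arrays e \<subseteq> {B..} \<Longrightarrow> val e (join B \<tau> (state x fl r)) = i \<Longrightarrow> i < N \<Longrightarrow>
      sem (send_sink B e) (join B \<tau> (state x fl r)) =
      join B (store (op_msg (insert_op (nbase + N + i))) \<tau>) (state x fl r)"
    using arrays_upper unfolding send_sink_def
    by (auto simp: send insert_op_def ends_def cap_def nbase_def)
qed

lemma sem_send_stage:
  assumes "ninit d \<le> x" "x < nops d"
  shows "sem (send_stage B d) (join B \<tau> (state x fl r)) =
    join B (store (op_msg (operation d x)) \<tau>) (state x fl r)"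
proof -
  have "0 < B" using B by simp
  note send = sem_send[OF this]
  let ?i = "(x - ninit d) div 3"
  have i: "?i < N" using assms by (auto simp: nops_def)
  have e: "ends (nbase + ?i) = (0, 2 + ?i)" "ends (nbase + N + ?i) = (2 + ?i, 1)"
    using i by (auto simp: ends_def nbase_def)
  show ?thesis
    using assms arrays_upper i e sem_send_edges(2,3)[of "stage_expr B d" \<tau> x fl r ?i]
    unfolding send_stage_def
    by (auto simp: send operation_def Let_def delete_op_def)
qed

lemma sem_send_operation:
  assumes "x < nops d"
  shows "sem (send_operation B d kk) (join B \<tau> (state x fl r)) =
    join B (store (op_msg (operation d x)) \<tau>) (state x fl r)"
proof -
  have init: "nbase \<le> ninit d" "2 * N * k \<le> nbase"
    using nedges by (auto simp: ninit_def nbase_def)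
  have ins: "operation d x = insert_op x" if "x < ninit d"
    using that by (simp add: operation_def)
  note src = sem_send_edges(2)[of "Bin Minus (Cell (B + 6) (Num 0)) (nbase_expr B)" \<tau> x fl r "x - nbase"]
  note snk = sem_send_edges(3)[of "Bin Minus (Cell (B + 6) (Num 0)) (Bin Plus (nbase_expr B) (Cell (B + 10) (Num 0)))"
      \<tau> x fl r "x - (nbase + N)"]
  consider (clause) "x < 2 * N * k" | (right) "2 * N * k \<le> x" "x < nbase"
    | (source) "nbase \<le> x" "x < nbase + N" "x < ninit d" | (sink) "nbase + N \<le> x" "x < ninit d"
    | (stage) "ninit d \<le> x" by linarith
  then show ?thesis
  proof cases
    case clause
    then show ?thesis using sem_send_clause[OF clause] ins init unfolding send_operation_def by simp
  next
    case right
    then show ?thesis using sem_send_edges(1)[OF right] ins init unfolding send_operation_def by simp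
  next
    case source
    then have d by (auto simp: ninit_def split: if_splits)
    then show ?thesis using source src arrays_upper ins init unfolding send_operation_def by simp
  next
    case sink
    then have d by (auto simp: ninit_def split: if_splits)
    then show ?thesis using sink snk arrays_upper ins init nedges
      unfolding send_operation_def by (simp add: ninit_def)
  next
    case stage
    then show ?thesis using sem_send_stage[OF stage assms] init nedges
      unfolding send_operation_def by (auto simp: ninit_def)
  qed
qed

end

definition iteration_speed :: "nat \<Rightarrow> bool \<Rightarrow> nat \<Rightarrow> nat" where
  "iteration_speed B d kk = speed (send_operation B d kk) + speed (check B d) +
     2 * test_speed (query_expr B d) + 2 * test_speed (less_expr (Cell (B + 6) (Num 0)) (nops_expr B d)) + 8"

definition preprocess_speed :: "nat \<Rightarrow> nat \<Rightarrow> nat" where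
  "preprocess_speed B kk = speed (parameters B) + loop_speed (move_test B kk) (move_input B) +
     speed (begin_positions B) + loop_speed (positions_test B) (positions B) +
     speed (begin_powers B) + loop_speed (powers_test B) (powers B) + speed (send_start B)"

text \<open>One width for everything the reduction handles: the input and its positions, the
  answers, and the operation counter.\<close>

locale driver_width = driver +
  fixes b :: nat
  assumes width: "2 + 2 * n + kk + k * Suc kk < 2 ^ b" "N * N < 2 ^ b" "nops d < 2 ^ b"
begin

definition taken :: "nat \<Rightarrow> nat \<Rightarrow> nat" where
  "taken q i = (if i < q then input i else 0)"

definition remaining :: "nat \<Rightarrow> mem" where
  "remaining q a i = (if a = 0 \<and> q \<le> i then input i else 0)"

lemma b_pos: "1 \<le> b"
proof (rule ccontr)
  assume "\<not> 1 \<le> b"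
  then have "b = 0" by simp
  then show False using width(1) by simp
qed

lemma value_bounds:
  "input i < 2 ^ b" "taken q i < 2 ^ b" "remaining q a i < 2 ^ b"
  "partial_positions q i < 2 ^ b \<or> k < q" "partial_powers q i < 2 ^ b \<or> h < q"
  "k < 2 ^ b" "h < 2 ^ b" "N < 2 ^ b" "q \<le> 2 + k * Suc kk \<Longrightarrow> q < 2 ^ b"
proof -
  have "input i < 2 ^ b" for i using input_le[of i] width(1) by simp
  then show "input i < 2 ^ b" "taken q i < 2 ^ b" "remaining q a i < 2 ^ b"
    by (auto simp: taken_def remaining_def)
  show "partial_positions q i < 2 ^ b \<or> k < q"
    using position_le[of i] width(1) by (auto simp: partial_positions_def)
  show N: "N < 2 ^ b" by (rule le_less_trans[OF le_square width(2)])
  show "partial_powers q i < 2 ^ b \<or> h < q"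
  proof (cases "i \<le> h")
    case True
    then have "2 ^ i \<le> N" unfolding N_def by (intro power_increasing) auto
    then have "2 ^ i < (2::nat) ^ b" using N by (rule le_less_trans)
    then show ?thesis by (simp add: partial_powers_def)
  qed (auto simp: partial_powers_def)
  show "k < 2 ^ b" "h < 2 ^ b" "q \<le> 2 + k * Suc kk \<Longrightarrow> q < 2 ^ b"
    using width(1) h_bounds by auto
qed

lemma small_state:
  assumes "x \<le> nops d" "fl \<le> 1" "r \<le> N * N"
  shows "small b {B..} (join B \<tau> (state x fl r))"
proof -
  have "fl < 2 ^ b" using assms(2) value_bounds(8) N_ge_2 by simp
  moreover have "r < 2 ^ b" "x < 2 ^ b" using assms width by (auto intro: le_less_trans)
  moreover have "partial_positions k i < 2 ^ b" "partial_powers h i < 2 ^ b" for i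
    using value_bounds(4)[of k i] value_bounds(5)[of h i] by auto
  ultimately show ?thesis unfolding state_def
    using value_bounds b_pos B by (intro small_memory) (simp_all add: subset_insertI)
qed

lemma state_update [simp]:
  "(state x fl r)(6 := (state x' fl' r' 6)(0 := y)) = state y fl r"
  "(state x fl r)(7 := (state x' fl' r' 7)(0 := y)) = state x y r"
  "(state x fl r)(11 := (state x' fl' r' 11)(0 := y)) = state x fl y"
  by (simp_all add: state_def)

lemma sem_check:
  assumes "x < nops d"
  shows "sem (check B d) (join B \<tau> (state x fl r)) =
    join B \<tau> (state (Suc x) (if operation d x = Query \<and> r \<noteq> full d x then 1 else fl) 0)"
  using assms by (simp add: check_def)

text \<open>Estimated by hand, as \<open>speed\<close> would need a bound on array \<open>1\<close>
  in every case. The answer is charged twice, when read and when written; with five unit costs this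
  gives the \<open>7\<close>.\<close>

lemma runs_fetch:
  assumes "x < nops d" "fl \<le> 1" "operation d x = Query \<Longrightarrow> \<tau> 1 0 \<le> N * N"
  shows "runs (Branch (query_expr B d) (fetch B) Skip) (join B \<tau> (state x fl 0))
    ((2 * test_speed (query_expr B d) + 7) * b)
    (join B \<tau> (state x fl (if operation d x = Query then \<tau> 1 0 else 0)))"
proof -
  let ?\<sigma> = "join B \<tau> (state x fl 0)" and ?e = "query_expr B d"
  have "small b {B..} ?\<sigma>" using assms by (intro small_state) auto
  then have c: "cost ?e ?\<sigma> \<le> test_speed ?e * b" "bits (val ?e ?\<sigma>) \<le> test_speed ?e * b"
    using test_speed[OF _ arrays_upper(10)] by auto
  have B1: "1 < B" using B by simp
  show ?thesis
  proof (cases "operation d x = Query")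
    case True
    let ?t = "cost (Num 0) ?\<sigma> + cost (Cell 1 (Num 0)) ?\<sigma> + 1 + bits (val (Num 0) ?\<sigma>) + bits (val (Cell 1 (Num 0)) ?\<sigma>)"
    have "exec (fetch B) ?\<sigma> ?t (join B \<tau> (state x fl (\<tau> 1 0)))"
      using exec.Assign[of "B + 11" "Num 0" "Cell 1 (Num 0)" ?\<sigma>] B1 by (simp add: fetch_def)
    then have "exec (Branch ?e (fetch B) Skip) ?\<sigma> (cost ?e ?\<sigma> + 1 + bits (val ?e ?\<sigma>) + ?t)
        (join B \<tau> (state x fl (\<tau> 1 0)))"
      using True assms by (intro exec.BranchT) simp_all
    moreover have "bits (\<tau> 1 0) \<le> b"
      using assms(3)[OF True] width(2) by (simp add: bits_le_iff)
    then have "cost ?e ?\<sigma> + 1 + bits (val ?e ?\<sigma>) + ?t \<le> (2 * test_speed ?e + 7) * b"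
      using c b_pos B1 by (simp add: algebra_simps floorlog_def)
    ultimately show ?thesis using True unfolding runs_def by auto
  next
    case False
    have "exec (Branch ?e (fetch B) Skip) ?\<sigma> (cost ?e ?\<sigma> + 1 + 1) ?\<sigma>"
      using False assms by (intro exec.BranchF exec.Skip) simp
    moreover have "cost ?e ?\<sigma> + 1 + 1 \<le> (2 * test_speed ?e + 7) * b"
      using c b_pos by (simp add: algebra_simps)
    ultimately show ?thesis using False unfolding runs_def by auto
  qed
qed

lemma iteration:
  assumes "x < nops d" "fl \<le> 1" "exec P (store (op_msg (operation d x)) \<tau>) t \<tau>'"
    and "operation d x = Query \<Longrightarrow> result \<tau>' \<le> N * N"
  shows "\<exists>u. exec (Seq (send_operation B d kk) (Seq P (Seq (Branch (query_expr B d) (fetch B) Skip) (check B d))))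
      (join B \<tau> (state x fl 0)) u
      (join B \<tau>' (state (Suc x) (if operation d x = Query \<and> result \<tau>' \<noteq> full d x then 1 else fl) 0)) \<and>
    u \<le> t + (speed (send_operation B d kk) + speed (check B d) + 2 * test_speed (query_expr B d) + 7) * b"
proof -
  let ?r = "if operation d x = Query then \<tau>' 1 0 else 0"
  let ?\<sigma> = "join B \<tau>' (state x fl ?r)"
  have "small b {B..} (join B \<tau> (state x fl 0))" using assms by (intro small_state) auto
  then obtain t1 where t1: "t1 \<le> speed (send_operation B d kk) * b"
    "exec (send_operation B d kk) (join B \<tau> (state x fl 0)) t1
      (join B (store (op_msg (operation d x)) \<tau>) (state x fl 0))"
    using speed[OF send_operation_shape(1) _ send_operation_shape(2)]
      sem_send_operation[OF assms(1), of \<tau> fl 0] unfolding runs_def by metis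
  obtain t2 where t2: "t2 \<le> (2 * test_speed (query_expr B d) + 7) * b"
    "exec (Branch (query_expr B d) (fetch B) Skip) (join B \<tau>' (state x fl 0)) t2 ?\<sigma>"
    using runs_fetch[OF assms(1,2), of \<tau>'] assms(4) unfolding runs_def result_def by blast
  have "small b {B..} ?\<sigma>" using assms by (intro small_state) (auto simp: result_def)
  then obtain t3 where t3: "t3 \<le> speed (check B d) * b"
    "exec (check B d) ?\<sigma> t3 (sem (check B d) ?\<sigma>)"
    using speed[OF check_shape(1) _ check_shape(2)] unfolding runs_def by blast
  have "sem (check B d) ?\<sigma> =
      join B \<tau>' (state (Suc x) (if operation d x = Query \<and> result \<tau>' \<noteq> full d x then 1 else fl) 0)"
    using sem_check[OF assms(1), of \<tau>' fl ?r] by (simp add: result_def)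
  then have "exec (Seq (send_operation B d kk) (Seq P (Seq (Branch (query_expr B d) (fetch B) Skip) (check B d))))
      (join B \<tau> (state x fl 0)) (t1 + (t + (t2 + t3)))
      (join B \<tau>' (state (Suc x) (if operation d x = Query \<and> result \<tau>' \<noteq> full d x then 1 else fl) 0))"
    using t1(2) t2(2) t3(2) exec_join[OF assms(3) accessed] by (auto intro!: exec.Seq)
  then show ?thesis using t1(1) t2(1) t3(1) by (intro exI conjI) (auto simp: algebra_simps)
qed

definition mismatch :: "nat list \<Rightarrow> nat \<Rightarrow> bool" where
  "mismatch outs x \<longleftrightarrow> (\<exists>y<x. operation d y = Query \<and> outs ! y \<noteq> full d y)"

lemma mismatch_Suc:
  "mismatch outs (Suc x) \<longleftrightarrow> mismatch outs x \<or> operation d x = Query \<and> outs ! x \<noteq> full d x"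
  by (auto simp: mismatch_def less_Suc_eq)

text \<open>Induction along the service of the remaining messages, for any position
  \<open>x\<close>. The flag records whether an earlier answer missed saturation, \<open>u\<close>
  is the subroutine's own time, and the extra round is the failing loop test.\<close>

lemma serve_loop_runs:
  assumes "serve Q msgs \<tau> u os" "Q = P" "msgs = map op_msg (drop x (ops d))" "os = drop x outs"
    and "x \<le> nops d" "length outs = nops d"
    and answers: "\<And>y. y < nops d \<Longrightarrow> operation d y = Query \<Longrightarrow> outs ! y \<le> N * N"
  shows "\<exists>t \<tau>'. exec (serve_loop B d kk P) (join B \<tau> (state x (of_bool (mismatch outs x)) 0)) t
      (join B \<tau>' (state (nops d) (of_bool (mismatch outs (nops d))) 0)) \<and>
    t \<le> u + (length msgs + 1) * (iteration_speed B d kk * b)"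
  using assms(1-5)
proof (induction arbitrary: x rule: serve.induct)
  case (Nil Q \<sigma>)
  let ?e = "less_expr (Cell (B + 6) (Num 0)) (nops_expr B d)"
  let ?\<sigma> = "join B \<sigma> (state x (of_bool (mismatch outs x)) 0)"
  have x: "x = nops d" using Nil by simp
  have "small b {B..} ?\<sigma>" using Nil by (intro small_state) auto
  then have c: "cost ?e ?\<sigma> \<le> test_speed ?e * b"
    using test_speed[of b "{B..}" ?\<sigma> ?e] arrays_upper(7)[of B d] by simp
  have "exec (serve_loop B d kk P) ?\<sigma> (cost ?e ?\<sigma> + 1) ?\<sigma>"
    unfolding serve_loop_def using x by (intro exec.WhileF) simp
  moreover have "cost ?e ?\<sigma> + 1 \<le> 0 + (length [] + 1) * (iteration_speed B d kk * b)"
    using c b_pos by (simp add: iteration_speed_def algebra_simps)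
  ultimately show ?case unfolding x by blast
next
  case (Cons Q msg \<sigma> t \<sigma>' msgs u os)
  let ?e = "less_expr (Cell (B + 6) (Num 0)) (nops_expr B d)"
  let ?fl = "of_bool (mismatch outs x)"
  let ?\<sigma> = "join B \<sigma> (state x ?fl 0)"
  let ?body = "Seq (send_operation B d kk) (Seq P (Seq (Branch (query_expr B d) (fetch B) Skip) (check B d)))"
  have "x \<noteq> nops d" using Cons.prems(2) by auto
  then have x: "x < nops d" using Cons.prems(4) by simp
  then have "drop x (ops d) = operation d x # drop (Suc x) (ops d)"
    using Cons_nth_drop_Suc[of x "ops d"] nth_ops[OF x] by simp
  then have msgs: "msg = op_msg (operation d x)" "msgs = map op_msg (drop (Suc x) (ops d))"
    using Cons.prems(2) by simp_all
  have "drop x outs = outs ! x # drop (Suc x) outs"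
    using Cons_nth_drop_Suc[of x outs] x assms(6) by simp
  then have os: "result \<sigma>' = outs ! x" "os = drop (Suc x) outs" using Cons.prems(3) by simp_all
  have "small b {B..} ?\<sigma>" using x by (intro small_state) auto
  then have c: "cost ?e ?\<sigma> \<le> test_speed ?e * b" "bits (val ?e ?\<sigma>) \<le> test_speed ?e * b"
    using test_speed[of b "{B..}" ?\<sigma> ?e] arrays_upper(7)[of B d] by simp_all
  have fl: "(if operation d x = Query \<and> result \<sigma>' \<noteq> full d x then 1 else ?fl) = of_bool (mismatch outs (Suc x))"
    using os(1) by (simp add: mismatch_Suc)
  have "exec P (store (op_msg (operation d x)) \<sigma>) t \<sigma>'"
    using Cons.hyps(1) msgs(1) Cons.prems(1) by simp
  moreover have "operation d x = Query \<Longrightarrow> result \<sigma>' \<le> N * N" using answers[OF x] os(1) by simp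
  moreover have "?fl \<le> (1 :: nat)" by simp
  ultimately obtain v where v: "exec ?body ?\<sigma> v (join B \<sigma>' (state (Suc x) (of_bool (mismatch outs (Suc x))) 0))"
    "v \<le> t + (speed (send_operation B d kk) + speed (check B d) + 2 * test_speed (query_expr B d) + 7) * b"
    using iteration[OF x] unfolding fl[symmetric] by blast
  obtain w \<tau>' where w: "exec (serve_loop B d kk P)
      (join B \<sigma>' (state (Suc x) (of_bool (mismatch outs (Suc x))) 0)) w
      (join B \<tau>' (state (nops d) (of_bool (mismatch outs (nops d))) 0))"
    "w \<le> u + (length msgs + 1) * (iteration_speed B d kk * b)"
    using Cons.IH[OF Cons.prems(1) msgs(2) os(2) Suc_leI[OF x]] by blast
  have "exec (serve_loop B d kk P) ?\<sigma> (cost ?e ?\<sigma> + 1 + bits (val ?e ?\<sigma>) + v + w)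
      (join B \<tau>' (state (nops d) (of_bool (mismatch outs (nops d))) 0))"
    unfolding serve_loop_def using x v(1) w(1)[unfolded serve_loop_def] by (intro exec.WhileT) simp_all
  moreover have "cost ?e ?\<sigma> + 1 + bits (val ?e ?\<sigma>) + v + w
      \<le> t + u + (length (msg # msgs) + 1) * (iteration_speed B d kk * b)"
  proof -
    have "cost ?e ?\<sigma> + 1 + bits (val ?e ?\<sigma>) + v \<le> t + iteration_speed B d kk * b"
      using c v(2) b_pos by (simp add: iteration_speed_def algebra_simps)
    then show ?thesis using w(2) by simp
  qed
  ultimately show ?case by blast
qed

section \<open>Preprocessing of the input\<close>

lemma taken_step: "(taken q)(q := input q) = taken (Suc q)" "taken 0 = (\<lambda>i. 0)"
  by (auto simp: taken_def fun_eq_iff)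

lemma remaining_step:
  "(remaining q)(0 := (remaining q 0)(q := 0)) = remaining (Suc q)" "remaining q 0 q = input q"
  by (auto simp: remaining_def fun_eq_iff)

lemma input_beyond: "2 + k * Suc kk \<le> i \<Longrightarrow> input i = 0"
  using position_le[of k] by (simp add: input_def length_enc_cnf)

text \<open>When the copy loop ends, the subroutine's part of memory is \<open>blank\<close>, as
  \<open>maintains_max_flow\<close> demands.\<close>

lemma moved: "taken (2 + k * Suc kk) = input" "remaining (2 + k * Suc kk) = blank"
  using input_beyond by (auto simp: taken_def remaining_def blank_def fun_eq_iff)

lemma positions_step:
  "q < k \<Longrightarrow> (partial_positions q)(Suc q := Suc (partial_positions q q + input (partial_positions q q))) =
    partial_positions (Suc q)"
  using position_Suc[of q] input_clause[of q 0]
  by (auto simp: partial_positions_def fun_eq_iff code_def)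

lemma powers_step:
  "(partial_powers q)(Suc q := partial_powers q q + partial_powers q q) = partial_powers (Suc q)"
  by (auto simp: partial_powers_def fun_eq_iff)

lemma first_steps:
  "(\<lambda>i. 0)(0 := 2) = partial_positions 0" "(\<lambda>i. 0)(0 := Suc 0) = partial_powers 0"
  by (auto simp: partial_positions_def partial_powers_def position_0 fun_eq_iff)

lemma store_input: "store (enc_cnf n F) blank = join B (remaining 0) (memory (\<lambda>i. 0) (\<lambda>i. 0) (\<lambda>i. 0) 0 0 0 0 0 0)"
  using B by (auto simp: store_def remaining_def input_def join_def memory_def blank_def fun_eq_iff)

lemma preprocess_runs:
  "runs (preprocess B kk) (store (enc_cnf n F) blank) (preprocess_speed B kk * b * (3 + k * Suc kk + k + h))
    (join B (store (start_msg nedges 0 1) blank) (state 0 0 0))"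
proof -
  let ?O = "\<lambda>i. 0 :: nat" and ?m = "2 + k * Suc kk" and ?R = "insert 0 {B..}"
  have B0: "0 < B" using B by simp
  have pos: "partial_positions q i < 2 ^ b" if "q \<le> k" for q i using value_bounds(4)[of q i] that by simp
  have pow: "partial_powers q i < 2 ^ b" if "q \<le> h" for q i using value_bounds(5)[of q i] that by simp
  have small_blank: "small b {B..} (join B \<tau> (memory Z st pw x 0 k h N' 0))"
    if "\<And>i. Z i < 2 ^ b" "\<And>i. st i < 2 ^ b" "\<And>i. pw i < 2 ^ b" "x < 2 ^ b" "N' < 2 ^ b" for \<tau> Z st pw x N'
    using that b_pos value_bounds(6,7) B0 by (intro small_memory) auto
  have 1: "runs (parameters B) (store (enc_cnf n F) blank) (speed (parameters B) * b)
      (join B (remaining 0) (memory (taken 0) ?O ?O 0 0 k h 0 0))"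
  proof -
    have "sem (parameters B) (store (enc_cnf n F) blank) = join B (remaining 0) (memory (taken 0) ?O ?O 0 0 k h 0 0)"
      using B0 input_0 input_1
      by (simp add: store_input parameters_def taken_step remaining_def h_def)
    moreover have "small b ?R (store (enc_cnf n F) blank)"
      unfolding store_input using b_pos value_bounds B0 by (intro small_memory) auto
    moreover have "loop_free (parameters B)" "read (parameters B) \<subseteq> ?R"
      by (auto simp: parameters_def)
    ultimately show ?thesis using speed by metis
  qed
  have 2: "runs (While (move_test B kk) (move_input B))
      (join B (remaining 0) (memory (taken 0) ?O ?O 0 0 k h 0 0))
      (Suc ?m * (loop_speed (move_test B kk) (move_input B) * b))
      (join B (remaining ?m) (memory (taken ?m) ?O ?O ?m 0 k h 0 0))"
  proof (rule runs_loop[where R = ?R and S = "\<lambda>q. join B (remaining q) (memory (taken q) ?O ?O q 0 k h 0 0)"])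
    fix q assume q: "q \<le> ?m"
    show "small b ?R (join B (remaining q) (memory (taken q) ?O ?O q 0 k h 0 0))"
      using b_pos value_bounds B0 q by (intro small_memory) auto
    show "val (move_test B kk) (join B (remaining q) (memory (taken q) ?O ?O q 0 k h 0 0)) = of_bool (q < ?m)"
      by (simp add: move_test_def)
  next
    fix q
    show "sem (move_input B) (join B (remaining q) (memory (taken q) ?O ?O q 0 k h 0 0)) =
        join B (remaining (Suc q)) (memory (taken (Suc q)) ?O ?O (Suc q) 0 k h 0 0)"
      using B0 by (simp add: move_input_def taken_step remaining_step)
  qed (auto simp: move_input_def move_test_def)
  have 3: "runs (begin_positions B) (join B blank (memory input ?O ?O ?m 0 k h 0 0)) (speed (begin_positions B) * b)
      (join B blank (memory input (partial_positions 0) ?O 0 0 k h 0 0))"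
  proof -
    have "sem (begin_positions B) (join B blank (memory input ?O ?O ?m 0 k h 0 0)) =
        join B blank (memory input (partial_positions 0) ?O 0 0 k h 0 0)"
      by (simp add: begin_positions_def first_steps)
    moreover have "small b {B..} (join B blank (memory input ?O ?O ?m 0 k h 0 0))"
      using value_bounds by (intro small_blank) auto
    moreover have "loop_free (begin_positions B)" "read (begin_positions B) \<subseteq> {B..}"
      by (auto simp: begin_positions_def)
    ultimately show ?thesis using speed by metis
  qed
  have 4: "runs (While (positions_test B) (positions B))
      (join B blank (memory input (partial_positions 0) ?O 0 0 k h 0 0))
      (Suc k * (loop_speed (positions_test B) (positions B) * b))
      (join B blank (memory input (partial_positions k) ?O k 0 k h 0 0))"
  proof (rule runs_loop[where R = "{B..}" and S = "\<lambda>q. join B blank (memory input (partial_positions q) ?O q 0 k h 0 0)"])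
    fix q assume q: "q \<le> k"
    show "small b {B..} (join B blank (memory input (partial_positions q) ?O q 0 k h 0 0))"
      using value_bounds(1,6) pos[OF q] q by (intro small_blank) auto
    show "val (positions_test B) (join B blank (memory input (partial_positions q) ?O q 0 k h 0 0)) = of_bool (q < k)"
      by (simp add: positions_test_def)
  next
    fix q assume "q < k"
    then show "sem (positions B) (join B blank (memory input (partial_positions q) ?O q 0 k h 0 0)) =
        join B blank (memory input (partial_positions (Suc q)) ?O (Suc q) 0 k h 0 0)"
      by (simp add: positions_def positions_step)
  qed (auto simp: positions_def positions_test_def)
  have 5: "runs (begin_powers B) (join B blank (memory input (partial_positions k) ?O k 0 k h 0 0))
      (speed (begin_powers B) * b)
      (join B blank (memory input (partial_positions k) (partial_powers 0) 0 0 k h 0 0))"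
  proof -
    have "sem (begin_powers B) (join B blank (memory input (partial_positions k) ?O k 0 k h 0 0)) =
        join B blank (memory input (partial_positions k) (partial_powers 0) 0 0 k h 0 0)"
      by (simp add: begin_powers_def first_steps)
    moreover have "small b {B..} (join B blank (memory input (partial_positions k) ?O k 0 k h 0 0))"
      using value_bounds(1,6) pos by (intro small_blank) auto
    moreover have "loop_free (begin_powers B)" "read (begin_powers B) \<subseteq> {B..}"
      by (auto simp: begin_powers_def)
    ultimately show ?thesis using speed by metis
  qed
  have 6: "runs (While (powers_test B) (powers B))
      (join B blank (memory input (partial_positions k) (partial_powers 0) 0 0 k h 0 0))
      (Suc h * (loop_speed (powers_test B) (powers B) * b))
      (join B blank (memory input (partial_positions k) (partial_powers h) h 0 k h 0 0))"
  proof (rule runs_loop[where R = "{B..}" and S = "\<lambda>q. join B blank (memory input (partial_positions k) (partial_powers q) q 0 k h 0 0)"])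
    fix q assume q: "q \<le> h"
    show "small b {B..} (join B blank (memory input (partial_positions k) (partial_powers q) q 0 k h 0 0))"
      using value_bounds(1,7) pos pow[OF q] q by (intro small_blank) auto
    show "val (powers_test B) (join B blank (memory input (partial_positions k) (partial_powers q) q 0 k h 0 0)) = of_bool (q < h)"
      by (simp add: powers_test_def)
  next
    fix q
    show "sem (powers B) (join B blank (memory input (partial_positions k) (partial_powers q) q 0 k h 0 0)) =
        join B blank (memory input (partial_positions k) (partial_powers (Suc q)) (Suc q) 0 k h 0 0)"
      by (simp add: powers_def powers_step)
  qed (auto simp: powers_def powers_test_def)
  have 7: "runs (send_start B) (join B blank (memory input (partial_positions k) (partial_powers h) h 0 k h 0 0))
      (speed (send_start B) * b)
      (join B (store (start_msg nedges 0 1) blank) (state 0 0 0))"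
  proof -
    have N: "partial_powers h h = N" by (simp add: partial_powers_def N_def)
    have "sem (send (Num 0) (nedges_expr B) (Num 0) (Num 1)) (join B blank (state 0 0 0)) =
        join B (store (start_msg nedges 0 1) blank) (state 0 0 0)"
      using sem_send[OF B0, of "Num 0" "nedges_expr B" "Num 0" "Num 1" blank "state 0 0 0"] arrays_upper(6)[of B]
      by (simp add: start_msg_def)
    then have "sem (send_start B) (join B blank (memory input (partial_positions k) (partial_powers h) h 0 k h 0 0)) =
        join B (store (start_msg nedges 0 1) blank) (state 0 0 0)"
      by (simp add: send_start_def N state_def)
    moreover have "small b {B..} (join B blank (memory input (partial_positions k) (partial_powers h) h 0 k h 0 0))"
      using value_bounds(1,7) pos pow by (intro small_blank) auto
    moreover have "loop_free (send_start B)" "read (send_start B) \<subseteq> {B..}" using arrays_upper(6)[of B]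
      by (auto simp: send_start_def)
    ultimately show ?thesis using speed by metis
  qed
  \<comment> \<open>A common bound for the number of tests in each of the three loops.\<close>
  let ?W = "3 + k * Suc kk + k + h"
  have total: "s1 * b + (Suc ?m * (s2 * b) + (s3 * b + (Suc k * (s4 * b) + (s5 * b + (Suc h * (s6 * b) + s7 * b)))))
      \<le> (s1 + s2 + s3 + s4 + s5 + s6 + s7) * b * ?W" for s1 s2 s3 s4 s5 s6 s7 :: nat
  proof -
    have "c * (s * b) \<le> ?W * (s * b)" if "c \<le> ?W" for c s using that by (rule mult_le_mono1)
    from this[of 1 s1] this[of "Suc ?m" s2] this[of 1 s3] this[of "Suc k" s4] this[of 1 s5]
      this[of "Suc h" s6] this[of 1 s7]
    have "1 * (s1 * b) + (Suc ?m * (s2 * b) + (1 * (s3 * b) + (Suc k * (s4 * b) + (1 * (s5 * b) + (Suc h * (s6 * b) + 1 * (s7 * b))))))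
      \<le> ?W * (s1 * b) + (?W * (s2 * b) + (?W * (s3 * b) + (?W * (s4 * b) + (?W * (s5 * b) + (?W * (s6 * b) + ?W * (s7 * b))))))"
      by (intro add_mono) simp_all
    also have "\<dots> = (s1 + s2 + s3 + s4 + s5 + s6 + s7) * b * ?W" by (simp only: algebra_simps)
    finally show ?thesis by simp
  qed
  show ?thesis
    unfolding preprocess_def preprocess_speed_def
    by (rule runs_mono[OF runs_Seq[OF 1 runs_Seq[OF 2[unfolded moved] runs_Seq[OF 3 runs_Seq[OF 4
      runs_Seq[OF 5 runs_Seq[OF 6 7]]]]]] total])
qed

end

lemma serve_length: "serve P msgs \<sigma> t outs \<Longrightarrow> length outs = length msgs"
  by (induction rule: serve.induct) auto

definition reduction_speed :: "nat \<Rightarrow> bool \<Rightarrow> nat \<Rightarrow> nat" where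
  "reduction_speed B d kk = preprocess_speed B kk + iteration_speed B d kk +
     speed (Assign 1 (Num 0) (Cell (B + 7) (Num 0)))"

lemma (in driver_width) reduction_runs:
  assumes serve: "serve P (start_msg nedges 0 1 # map op_msg (ops d)) blank u (out0 # outs)"
    and answers: "\<And>y. y < nops d \<Longrightarrow> operation d y = Query \<Longrightarrow> outs ! y \<le> N * N"
  shows "\<exists>t \<sigma>. exec (reduction B d kk P) (store (enc_cnf n F) blank) t \<sigma> \<and>
    (result \<sigma> = 1 \<longleftrightarrow> mismatch outs (nops d)) \<and>
    t \<le> u + reduction_speed B d kk * b * (nops d + (4 + k * Suc kk + k + h))"
proof -
  obtain u1 u2 \<tau>1 where u: "u = u1 + u2" "exec P (store (start_msg nedges 0 1) blank) u1 \<tau>1"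
    "serve P (map op_msg (ops d)) \<tau>1 u2 outs"
    using serve by (cases rule: serve.cases) auto
  have len: "length outs = nops d" using serve_length[OF u(3)] by simp
  obtain t0 where t0: "t0 \<le> preprocess_speed B kk * b * (3 + k * Suc kk + k + h)"
    "exec (preprocess B kk) (store (enc_cnf n F) blank) t0 (join B (store (start_msg nedges 0 1) blank) (state 0 0 0))"
    using preprocess_runs unfolding runs_def by blast
  note t1 = exec_join[OF u(2) accessed, of "state 0 0 0"]
  have "mismatch outs 0 = False" by (simp add: mismatch_def)
  then obtain t2 \<tau>2 where t2: "exec (serve_loop B d kk P) (join B \<tau>1 (state 0 0 0)) t2
      (join B \<tau>2 (state (nops d) (of_bool (mismatch outs (nops d))) 0))"
    "t2 \<le> u2 + (nops d + 1) * (iteration_speed B d kk * b)"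
    using serve_loop_runs[OF u(3), of 0 outs] len answers by auto
  let ?\<sigma> = "join B \<tau>2 (state (nops d) (of_bool (mismatch outs (nops d))) 0)"
  let ?last = "Assign 1 (Num 0) (Cell (B + 7) (Num 0))"
  have "small b {B..} ?\<sigma>" by (intro small_state) auto
  then have "runs ?last ?\<sigma> (speed ?last * b) (sem ?last ?\<sigma>)"
    by (intro speed) auto
  then obtain t3 where t3: "t3 \<le> speed ?last * b" "exec ?last ?\<sigma> t3 (sem ?last ?\<sigma>)"
    unfolding runs_def by blast
  have "exec (reduction B d kk P) (store (enc_cnf n F) blank) (t0 + (u1 + (t2 + t3))) (sem ?last ?\<sigma>)"
    unfolding reduction_def by (rule exec.Seq[OF t0(2) exec.Seq[OF t1 exec.Seq[OF t2(1) t3(2)]]])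
  moreover have "result (sem ?last ?\<sigma>) = 1 \<longleftrightarrow> mismatch outs (nops d)"
    using B by (simp add: result_def)
  moreover have "t0 + (u1 + (t2 + t3)) \<le> u + reduction_speed B d kk * b * (nops d + (4 + k * Suc kk + k + h))"
  proof -
    let ?W = "nops d + (4 + k * Suc kk + k + h)"
    have "preprocess_speed B kk * b * (3 + k * Suc kk + k + h) \<le> preprocess_speed B kk * b * ?W"
      by (intro mult_le_mono2) simp
    moreover have "(nops d + 1) * (iteration_speed B d kk * b) \<le> ?W * (iteration_speed B d kk * b)"
      by (intro mult_le_mono1) simp
    moreover have "1 * (speed ?last * b) \<le> ?W * (speed ?last * b)"
      by (intro mult_le_mono1) simp
    moreover have "preprocess_speed B kk * b * ?W + ?W * (iteration_speed B d kk * b) + ?W * (speed ?last * b) =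
        reduction_speed B d kk * b * ?W"
      unfolding reduction_speed_def by (simp only: algebra_simps)
    ultimately show ?thesis using t0(1) t2(2) t3(1) u(1) by linarith
  qed
  ultimately show ?thesis
    by (intro exI[of _ "t0 + (u1 + (t2 + t3))"] exI[of _ "sem ?last ?\<sigma>"] conjI)
qed

section \<open>Correctness and total time of the reduction\<close>

lemma (in driver) reduction_decides:
  assumes maintains: "maintains_max_flow P nedges 0 1 (ops d) T"
    and width: "2 + 2 * n + kk + k * Suc kk < 2 ^ b" "N * N < 2 ^ b" "nops d < 2 ^ b"
  shows "\<exists>t \<sigma>. exec (reduction B d kk P) (store (enc_cnf n F) blank) t \<sigma> \<and>
    (result \<sigma> = 1 \<longleftrightarrow> satisfiable F) \<and>
    real t \<le> T + real (reduction_speed B d kk * b * (nops d + (4 + k * Suc kk + k + h)))"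
proof -
  interpret driver_width P B kk n F d b
    by unfold_locales (rule width)+
  obtain u out0 outs where serve: "serve P (start_msg nedges 0 1 # map op_msg (ops d)) blank u (out0 # outs)"
    and correct: "\<forall>i<length (ops d). ops d ! i = Query \<longrightarrow>
      is_max_flow_value nedges (graph_after (take i (ops d))) 0 1 (real (outs ! i))"
    and u: "real u \<le> T"
    using maintains unfolding maintains_max_flow_def by blast
  have val: "is_max_flow_value nedges (graph_after (take y (ops d))) 0 1 (real (outs ! y))"
    if "y < nops d" "operation d y = Query" for y
    using correct that nth_ops[OF that(1)] by simp
  have "outs ! y \<le> N * N" if y: "y < nops d" "operation d y = Query" for y
  proof -
    obtain i where "i < N" "y = ninit d + 3 * i + 1" using operation_query[OF y] .
    then show ?thesis using query_value(2) val[OF y] by blast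
  qed
  then obtain t \<sigma> where t: "exec (reduction B d kk P) (store (enc_cnf n F) blank) t \<sigma>"
    "result \<sigma> = 1 \<longleftrightarrow> mismatch outs (nops d)"
    "t \<le> u + reduction_speed B d kk * b * (nops d + (4 + k * Suc kk + k + h))"
    using reduction_runs[OF serve] by blast
  have "mismatch outs (nops d) \<longleftrightarrow> (\<exists>i<N. \<exists>l<N. \<not> blocked i l)"
    unfolding mismatch_def by (rule query_value_full_iff[OF val])
  also have "\<dots> \<longleftrightarrow> satisfiable F"
    using satisfiable_split[OF F, of h] h_bounds unfolding N_def[symmetric] k_def[symmetric]
    by (auto simp: blocked_def Suc_le_eq)
  finally have "result \<sigma> = 1 \<longleftrightarrow> satisfiable F" using t(2) by simp
  moreover have "real t \<le> T + real (reduction_speed B d kk * b * (nops d + (4 + k * Suc kk + k + h)))"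
    using t(3) u by linarith
  ultimately show ?thesis using t(1) by blast
qed

text \<open>Taking the minimum with \<open>1\<close> keeps the exponent
  \<open>1 - 2 * \<delta>\<close> nonnegative, so powers stay monotone in the base. Halving reflects
  that \<open>N\<close> is about \<open>2 powr (n / 2)\<close>.\<close>

lemma (in driver) reduction_time:
  assumes "k \<le> c * n" and Q: "Q = 20 + kk + c * (kk + 5)" and \<delta>: "\<delta> = min \<epsilon> 1 / 2" "0 < \<epsilon>"
  shows "\<exists>b. 2 + 2 * n + kk + k * Suc kk < 2 ^ b \<and> N * N < 2 ^ b \<and> nops d < 2 ^ b \<and>
    A * real nedges powr (1 - \<epsilon>) * real (nops d) + real (R * b * (nops d + (4 + k * Suc kk + k + h)))
      \<le> (4 * \<bar>A\<bar> * real Q ^ 2 + 2 * real R * real Q ^ 2) * 2 powr ((1 - \<delta>) * real n) * real (n + 1) ^ 2"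
proof -
  let ?V = "2 + 2 * n + kk + k * Suc kk" and ?M = "2 * k + 6" and ?E = "2 powr ((1 - \<delta>) * real n)"
  \<comment> \<open>A sum of three exponents that suffice for the three width conditions, and still
    linear in \<open>n\<close>.\<close>
  define b where "b = 2 * h + ?V + ?M"
  have nops: "nops d \<le> N * ?M" by (simp add: nops_def ninit_def nbase_def nedges_def algebra_simps)
  have nedges: "nedges \<le> N * ?M" "1 \<le> nedges"
    using nedges_ge(2) by (simp_all add: nedges_def algebra_simps)
  have Q2: "?M \<le> Q * (n + 1)" "b \<le> Q * (n + 1)" "?M + (4 + k * Suc kk + k + h) \<le> Q * (n + 1)"
  proof -
    \<comment> \<open>Naming the products makes the three bounds linear in the remaining
      quantities.\<close>
    define u v y where "u = k * kk" and "v = c * n" and "y = c * n * kk"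
    have "u \<le> y" "k \<le> v" using assms(1) unfolding u_def v_def y_def by (auto intro: mult_le_mono1)
    moreover have "Q * (n + 1) = 20 + kk + c * kk + 5 * c + 20 * n + kk * n + y + 5 * v"
      by (simp add: Q v_def y_def algebra_simps)
    moreover have "k * Suc kk = k + u" by (simp add: u_def)
    ultimately show "?M \<le> Q * (n + 1)" "b \<le> Q * (n + 1)" "?M + (4 + k * Suc kk + k + h) \<le> Q * (n + 1)"
      using h_bounds(3) unfolding b_def by linarith+
  qed
  have pow: "v < 2 ^ b" if "v < 2 ^ i" "i \<le> b" for v i :: nat
  proof -
    have "2 ^ i \<le> (2::nat) ^ b" using that(2) by (intro power_increasing) auto
    with that(1) show ?thesis by (rule less_le_trans)
  qed
  have "?V < 2 ^ b" by (rule pow[OF less_exp]) (simp add: b_def)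
  moreover have "N * N < 2 ^ b"
  proof -
    have "N * N = 2 ^ (2 * h)" by (simp add: N_def mult_2 power_add)
    also have "\<dots> < (2::nat) ^ b" by (intro power_strict_increasing) (auto simp: b_def)
    finally show ?thesis .
  qed
  moreover have "nops d < 2 ^ b"
  proof (rule pow)
    have "nops d \<le> 2 ^ h * ?M" using nops by (simp add: N_def)
    also have "\<dots> < 2 ^ h * 2 ^ ?M" by (intro mult_strict_left_mono less_exp) simp
    also have "\<dots> = 2 ^ (h + ?M)" by (rule power_add[symmetric])
    finally show "nops d < 2 ^ (h + ?M)" .
  qed (simp add: b_def)
  moreover have "A * real nedges powr (1 - \<epsilon>) * real (nops d) + real (R * b * (nops d + (4 + k * Suc kk + k + h)))
      \<le> (4 * \<bar>A\<bar> * real Q ^ 2 + 2 * real R * real Q ^ 2) * ?E * real (n + 1) ^ 2"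
  proof -
    let ?q = "real Q * real (n + 1)"
    have \<delta>01: "0 < \<delta>" "2 * \<delta> \<le> \<epsilon>" "2 * \<delta> \<le> 1" using \<delta>(2) unfolding \<delta>(1) by (simp_all add: min_def)
    have q: "real ?M \<le> ?q" "real b \<le> ?q" "real (?M + (4 + k * Suc kk + k + h)) \<le> ?q"
      using Q2 unfolding of_nat_mult[symmetric] of_nat_le_iff by auto
    have N0: "1 \<le> real N" using N_ge_2 by simp
    have N: "real N \<le> 2 powr (real n / 2 + 1)"
    proof -
      have "real N = 2 powr real h" by (simp add: N_def powr_realpow)
      also have "\<dots> \<le> 2 powr (real n / 2 + 1)" by (intro powr_mono) (auto simp: h_def)
      finally show ?thesis .
    qed
    \<comment> \<open>The reduction's own work is \<open>N\<close> times a polynomial; it fits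
      because \<open>\<delta>\<close> is at most one half.\<close>
    have N1: "real N \<le> 2 * ?E"
    proof -
      have "real n / 2 \<le> (1 - \<delta>) * real n"
        using mult_right_mono[of "1 / 2" "1 - \<delta>" "real n"] \<delta>01 by simp
      then have "2 powr (real n / 2 + 1) \<le> 2 powr ((1 - \<delta>) * real n + 1)" by (intro powr_mono) auto
      with N have "real N \<le> 2 powr ((1 - \<delta>) * real n + 1)" by (rule order_trans)
      then show ?thesis by (simp add: powr_add)
    qed
    \<comment> \<open>The time of \<open>P\<close>: one factor \<open>N\<close> counts operations,
      the rest is the cost of each.\<close>
    have N2: "real N powr (2 - 2 * \<delta>) \<le> 4 * ?E"
    proof -
      have "real N powr (2 - 2 * \<delta>) \<le> (2 powr (real n / 2 + 1)) powr (2 - 2 * \<delta>)"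
        using N \<delta>01 by (intro powr_mono2) auto
      also have "\<dots> = 2 powr ((1 - \<delta>) * real n + (2 - 2 * \<delta>))"
        unfolding powr_powr by (rule arg_cong[where f = "\<lambda>x. 2 powr x"]) (simp add: algebra_simps)
      also have "\<dots> \<le> 2 powr ((1 - \<delta>) * real n + 2)" using \<delta>01 by (intro powr_mono) auto
      also have "\<dots> = 4 * ?E" by (simp add: powr_add)
      finally show ?thesis .
    qed
    have M1: "1 \<le> real ?M" by simp
    have le: "real nedges \<le> real N * real ?M"
      using nedges(1) unfolding of_nat_mult[symmetric] of_nat_le_iff .
    have "real nedges powr (1 - \<epsilon>) * real (nops d) \<le> (real N * real ?M) powr (1 - 2 * \<delta>) * (real N * real ?M)"
    proof (rule mult_mono)
      have "real nedges powr (1 - \<epsilon>) \<le> real nedges powr (1 - 2 * \<delta>)"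
        using nedges(2) \<delta>01 by (intro powr_mono) auto
      also have "\<dots> \<le> (real N * real ?M) powr (1 - 2 * \<delta>)"
        by (intro powr_mono2 le) (use \<delta>01 in simp_all)
      finally show "real nedges powr (1 - \<epsilon>) \<le> (real N * real ?M) powr (1 - 2 * \<delta>)" .
      show "real (nops d) \<le> real N * real ?M"
        using nops unfolding of_nat_mult[symmetric] of_nat_le_iff .
    qed auto
    also have "\<dots> = (real N * real ?M) powr (2 - 2 * \<delta>)"
    proof -
      have e: "2 - 2 * \<delta> = (1 - 2 * \<delta>) + 1" by simp
      have "0 \<le> real N * real ?M" by simp
      then show ?thesis by (simp only: e powr_add powr_one)
    qed
    also have "\<dots> = real N powr (2 - 2 * \<delta>) * real ?M powr (2 - 2 * \<delta>)"
      by (rule powr_mult)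
    also have "\<dots> \<le> (4 * ?E) * ?q ^ 2"
    proof (rule mult_mono[OF N2])
      have "real ?M powr (2 - 2 * \<delta>) \<le> real ?M powr 2" using M1 \<delta>01 by (intro powr_mono) auto
      also have "\<dots> = real ?M ^ 2" using M1 by (subst powr_numeral) auto
      also have "\<dots> \<le> ?q ^ 2" using q(1) by (intro power_mono) auto
      finally show "real ?M powr (2 - 2 * \<delta>) \<le> ?q ^ 2" .
    qed auto
    finally have main: "real nedges powr (1 - \<epsilon>) * real (nops d) \<le> (4 * ?E) * ?q ^ 2" .
    \<comment> \<open>The sign of \<open>A\<close> is unknown, so its absolute value takes
      over.\<close>
    have "A * (real nedges powr (1 - \<epsilon>) * real (nops d)) \<le> \<bar>A\<bar> * (real nedges powr (1 - \<epsilon>) * real (nops d))"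
      by (intro mult_right_mono) auto
    also have "\<dots> \<le> \<bar>A\<bar> * ((4 * ?E) * ?q ^ 2)" by (intro mult_left_mono main) auto
    finally have 1: "A * real nedges powr (1 - \<epsilon>) * real (nops d) \<le> \<bar>A\<bar> * ((4 * ?E) * ?q ^ 2)"
      by (simp only: mult.assoc)
    have X: "x \<le> N * x" for x using mult_le_mono1[of 1 N x] N_ge_2 by simp
    have "nops d + (4 + k * Suc kk + k + h) \<le> N * ?M + N * (4 + k * Suc kk + k + h)"
      by (rule add_mono[OF nops X])
    also have "\<dots> = N * (?M + (4 + k * Suc kk + k + h))" by (simp only: distrib_left)
    finally have "real (nops d + (4 + k * Suc kk + k + h)) \<le> real N * real (?M + (4 + k * Suc kk + k + h))"
      unfolding of_nat_mult[symmetric] of_nat_le_iff .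
    also have "\<dots> \<le> (2 * ?E) * ?q" using N1 q(3) by (intro mult_mono) auto
    finally have W: "real (nops d + (4 + k * Suc kk + k + h)) \<le> (2 * ?E) * ?q" .
    have "real (R * b * (nops d + (4 + k * Suc kk + k + h))) =
        real R * (real b * real (nops d + (4 + k * Suc kk + k + h)))"
      by (simp only: of_nat_mult mult.assoc)
    also have "\<dots> \<le> real R * (?q * ((2 * ?E) * ?q))"
      using q(2) W by (intro mult_left_mono mult_mono) auto
    finally have "A * real nedges powr (1 - \<epsilon>) * real (nops d) + real (R * b * (nops d + (4 + k * Suc kk + k + h)))
        \<le> \<bar>A\<bar> * ((4 * ?E) * ?q ^ 2) + real R * (?q * ((2 * ?E) * ?q))" using 1 by linarith
    also have "\<dots> = (4 * \<bar>A\<bar> * real Q ^ 2 + 2 * real R * real Q ^ 2) * ?E * real (n + 1) ^ 2"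
      by (simp only: power2_eq_square algebra_simps)
    finally show ?thesis .
  qed
  ultimately show ?thesis by (intro exI[of _ b] conjI)
qed

text \<open>The order of choices matters: the program depends on \<open>P\<close>, \<open>d\<close>
  and \<open>kk\<close> only, while the clause density \<open>c'\<close> enters just the constant of
  the time bound.\<close>

lemma solves_imp_sparse_ksat:
  assumes "solves d c w \<epsilon> P" "1 \<le> c" "1 \<le> w" "0 < \<epsilon>"
  shows "\<exists>P'. solves_sparse_ksat (min \<epsilon> 1 / 2) kk P'"
proof -
  obtain A where A: "\<And>N k sat. 2 \<le> N \<Longrightarrow> maintains_max_flow P (network.nedges N k) 0 1
    (network.ops N k sat d) (A * real (network.nedges N k) powr (1 - \<epsilon>) * real (network.nops N k d))"
    using solves_maintains[OF assms(1-3)] by blast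
  obtain B0 where B0: "\<forall>a\<in>accessed P. a < B0" using finite_accessed finite_nat_set_iff_bounded by blast
  define B where "B = B0 + 2"
  have B: "accessed P \<subseteq> {..<B}" "2 \<le> B" using B0 by (auto simp: B_def less_SucI)
  let ?P = "reduction B d kk P" and ?R = "reduction_speed B d kk"
  have "\<exists>A' p. \<forall>n F. k_cnf kk n F \<and> length F \<le> c' * n \<longrightarrow>
      (\<exists>t \<sigma>. exec ?P (store (enc_cnf n F) blank) t \<sigma> \<and> (result \<sigma> = 1 \<longleftrightarrow> satisfiable F) \<and>
        real t \<le> A' * 2 powr ((1 - min \<epsilon> 1 / 2) * real n) * real (n + 1) ^ p)" for c' :: nat
  proof -
    let ?Q = "20 + kk + c' * (kk + 5)"
    let ?A = "4 * \<bar>A\<bar> * real ?Q ^ 2 + 2 * real ?R * real ?Q ^ 2"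
    have main: "\<exists>t \<sigma>. exec ?P (store (enc_cnf n F) blank) t \<sigma> \<and> (result \<sigma> = 1 \<longleftrightarrow> satisfiable F) \<and>
        real t \<le> ?A * 2 powr ((1 - min \<epsilon> 1 / 2) * real n) * real (n + 1) ^ 2"
      if cnf: "k_cnf kk n F" "length F \<le> c' * n" for n F
    proof -
      interpret driver P B kk n F d using B cnf(1) by unfold_locales
      have k: "k \<le> c' * n" using cnf(2) by (simp add: k_def)
      obtain b where b: "2 + 2 * n + kk + k * Suc kk < 2 ^ b" "N * N < 2 ^ b" "nops d < 2 ^ b"
        and time: "A * real nedges powr (1 - \<epsilon>) * real (nops d) + real (?R * b * (nops d + (4 + k * Suc kk + k + h)))
          \<le> ?A * 2 powr ((1 - min \<epsilon> 1 / 2) * real n) * real (n + 1) ^ 2"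
        using reduction_time[OF k refl refl assms(4), of A ?R] by (elim exE conjE)
      obtain t \<sigma> where t: "exec ?P (store (enc_cnf n F) blank) t \<sigma>" "result \<sigma> = 1 \<longleftrightarrow> satisfiable F"
        "real t \<le> A * real nedges powr (1 - \<epsilon>) * real (nops d) + real (?R * b * (nops d + (4 + k * Suc kk + k + h)))"
        using reduction_decides[OF A[OF N_ge_2] b] by (elim exE conjE)
      show ?thesis
        using t(1,2) order_trans[OF t(3) time] by (intro exI[of _ t] exI[of _ \<sigma>] conjI)
    qed
    show ?thesis
      by (rule exI[of _ ?A], rule exI[of _ 2], intro allI impI) (rule main; simp)
  qed
  then show ?thesis unfolding solves_sparse_ksat_def by (intro exI[of _ ?P] allI)
qed

theorem theorem2:
  assumes SETH
  shows "\<forall>\<epsilon>>0. \<forall>c\<ge>1. \<forall>w\<ge>1.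
    \<not> (\<exists>P. solves_incremental_max_flow c w \<epsilon> P) \<and>
    \<not> (\<exists>P. solves_decremental_max_flow c w \<epsilon> P)"
proof -
  have "\<not> solves d c w \<epsilon> P" if "0 < \<epsilon>" "1 \<le> c" "1 \<le> w" for d c w \<epsilon> P
  proof
    assume "solves d c w \<epsilon> P"
    \<comment> \<open>The gain \<open>min \<epsilon> 1 / 2\<close> is the same for all clause
      widths, which is what contradicts \<open>SETH\<close>.\<close>
    then have "\<exists>P'. solves_sparse_ksat (min \<epsilon> 1 / 2) kk P'" for kk
      using solves_imp_sparse_ksat that by blast
    moreover have "0 < min \<epsilon> 1 / 2" using that(1) by simp
    ultimately show False using assms unfolding SETH_def by blast
  qed
  from this[where d = False] this[where d = True] show ?thesis
    unfolding solves_def by auto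
qed

end
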